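(* Let $G$ be a nilpotent $U_{0,r}$-group. Let $\{H_i\}_{i\le n}$ be a (finite) family of definable subgroups of $G$ such that $G=\langle \bigcup_i H_i\rangle$. Then $G=\langle \bigcup_i U_{0,r}(H_i)\rangle$.
   Context: "Definable" means definable in the ambient structure of finite Morley rank; $\mathrm{rk}$ denotes Morley rank. A group of finite Morley rank is connected if it has no proper definable subgroup of finite index. The symbol $<$ denotes proper containment of subgroups. An abelian group $A$ of finite Morley rank is indecomposable if there are no two proper definable subgroups $A_1,A_2<A$ with $A_1+A_2=A$. For a nontrivial definable abelian group $A$, a definable supplement of a subgroup $B\le A$ is a proper definable subgroup $C<A$ with $B+C=A$; the radical $J(A)$ is the (unique) maximal proper definable connected subgroup of $A$ without a definable supplement in $A$. The reduced rank of $A$ is $\bar r(A)=\mathrm{rk}(A/J(A))$. For a group $G$ of finite Morley rank and an integer $r$, $U_{0,r}(G)$ is the subgroup generated by all definable indecomposable abelian subgroups $A\le G$ with $\bar r(A)=r$ and $A/J(A)$ torsion-free. A $U_{0,r}$-group is a group $G$ of finite Morley rank with $U_{0,r}(G)=G$. *)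

theory Defs
  imports "HOL-Algebra.Algebra"
begin

section \<open>First-order structures\<close>

datatype 'f trm = Var nat | App 'f "'f trm list"

datatype ('f, 'r) form =
    Eq "'f trm" "'f trm"
  | Rel 'r "'f trm list"
  | Neg "('f, 'r) form"
  | Conj "('f, 'r) form" "('f, 'r) form"
  | Exists nat "('f, 'r) form"

text \<open>Symbols carry no arity: a structure interprets each symbol at argument lists of every length.
  A language with arities is the special case in which the interpretation at the wrong lengths is
  constant, which does not affect definability with parameters.\<close>

record ('a, 'f, 'r) fo_structure =
  univ :: "'a set"
  funs :: "'f \<Rightarrow> 'a list \<Rightarrow> 'a"
  rels :: "'r \<Rightarrow> 'a list \<Rightarrow> bool"

definition is_structure :: "('a, 'f, 'r) fo_structure \<Rightarrow> bool" where
  "is_structure M \<longleftrightarrow>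
     univ M \<noteq> {} \<and> (\<forall>f xs. set xs \<subseteq> univ M \<longrightarrow> funs M f xs \<in> univ M)"

primrec trm_val :: "('a, 'f, 'r) fo_structure \<Rightarrow> (nat \<Rightarrow> 'a) \<Rightarrow> 'f trm \<Rightarrow> 'a" where
  "trm_val M s (Var v) = s v"
| "trm_val M s (App f ts) = funs M f (map (trm_val M s) ts)"

primrec sat :: "('a, 'f, 'r) fo_structure \<Rightarrow> (nat \<Rightarrow> 'a) \<Rightarrow> ('f, 'r) form \<Rightarrow> bool" where
  "sat M s (Eq t u) \<longleftrightarrow> trm_val M s t = trm_val M s u"
| "sat M s (Rel R ts) \<longleftrightarrow> rels M R (map (trm_val M s) ts)"
| "sat M s (Neg \<phi>) \<longleftrightarrow> \<not> sat M s \<phi>"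
| "sat M s (Conj \<phi> \<psi>) \<longleftrightarrow> sat M s \<phi> \<and> sat M s \<psi>"
| "sat M s (Exists v \<phi>) \<longleftrightarrow> (\<exists>a\<in>univ M. sat M (s(v := a)) \<phi>)"

definition elementary_embedding ::
    "('a, 'f, 'r) fo_structure \<Rightarrow> ('b, 'f, 'r) fo_structure \<Rightarrow> ('a \<Rightarrow> 'b) \<Rightarrow> bool" where
  "elementary_embedding M N h \<longleftrightarrow>
     is_structure M \<and> is_structure N \<and> h ` univ M \<subseteq> univ N \<and>
     (\<forall>\<phi> s. range s \<subseteq> univ M \<longrightarrow> (sat N (h \<circ> s) \<phi> \<longleftrightarrow> sat M s \<phi>))"


section \<open>Definable sets\<close>

text \<open>A formula together with an assignment of parameters. When it is read as defining a set of
  \<open>k\<close>-tuples, the variables \<open>0, \<dots>, k - 1\<close> are the coordinates of the tuple and the assignment only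
  supplies the values of the remaining variables.\<close>

type_synonym ('a, 'f, 'r) pform = "('f, 'r) form \<times> (nat \<Rightarrow> 'a)"

definition params_in :: "('a, 'f, 'r) fo_structure \<Rightarrow> ('a, 'f, 'r) pform \<Rightarrow> bool" where
  "params_in M P \<longleftrightarrow> range (snd P) \<subseteq> univ M"

definition tuples :: "('a, 'f, 'r) fo_structure \<Rightarrow> nat \<Rightarrow> 'a list set" where
  "tuples M k = {xs. length xs = k \<and> set xs \<subseteq> univ M}"

definition defined_set ::
    "('a, 'f, 'r) fo_structure \<Rightarrow> nat \<Rightarrow> ('a, 'f, 'r) pform \<Rightarrow> 'a list set" where
  "defined_set M k P =
     {xs \<in> tuples M k. sat M (\<lambda>i. if i < k then xs ! i else snd P i) (fst P)}"

definition transport :: "('a \<Rightarrow> 'b) \<Rightarrow> ('a, 'f, 'r) pform \<Rightarrow> ('b, 'f, 'r) pform" where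
  "transport h P = (fst P, h \<circ> snd P)"

text \<open>Definability is with parameters.\<close>

definition definable :: "('a, 'f, 'r) fo_structure \<Rightarrow> nat \<Rightarrow> 'a list set \<Rightarrow> bool" where
  "definable M k S \<longleftrightarrow> (\<exists>P. params_in M P \<and> defined_set M k P = S)"


section \<open>Morley rank\<close>

text \<open>Morley rank is needed for interpretable sets \<open>S/E\<close>, where \<open>S\<close> is a definable set of \<open>k\<close>-tuples
  and \<open>E\<close> a definable equivalence relation on \<open>S\<close>, given as a set of \<open>2k\<close>-tuples. The definable
  subsets of \<open>S/E\<close> are represented by the \<open>E\<close>-invariant definable subsets of \<open>S\<close>. The recursion is
  the usual one: the rank is at least \<open>0\<close> iff the set is nonempty, and at least \<open>n + 1\<close> iff in some
  elementary extension \<open>N'\<close> of \<open>N\<close> the set contains infinitely many pairwise disjoint definable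
  subsets of rank at least \<open>n\<close>.\<close>

primrec morley_ge ::
    "nat \<Rightarrow> ('b, 'f, 'r) fo_structure \<Rightarrow> nat \<Rightarrow> ('b, 'f, 'r) pform \<Rightarrow> ('b, 'f, 'r) pform \<Rightarrow> bool" where
  "morley_ge 0 N k E S \<longleftrightarrow> defined_set N k S \<noteq> {}"
| "morley_ge (Suc n) N k E S \<longleftrightarrow>
     (\<exists>(N' :: ('b, 'f, 'r) fo_structure) h (Y :: nat \<Rightarrow> ('b, 'f, 'r) pform).
        elementary_embedding N N' h \<and>
        (\<forall>i. params_in N' (Y i) \<and>
             defined_set N' k (Y i) \<subseteq> defined_set N' k (transport h S) \<and>
             (\<forall>x y. x \<in> defined_set N' k (Y i) \<and> y \<in> tuples N' k \<and>
                     x @ y \<in> defined_set N' (2 * k) (transport h E) \<longrightarrow>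
                     y \<in> defined_set N' k (Y i))) \<and>
        (\<forall>i j. i \<noteq> j \<longrightarrow> defined_set N' k (Y i) \<inter> defined_set N' k (Y j) = {}) \<and>
        (\<forall>i. morley_ge n N' k (transport h E) (Y i)))"

text \<open>A set \<open>Q\<close> of pairwise disjoint nonempty sets of \<open>k\<close>-tuples stands for the interpretable set
  \<open>S/E\<close>, where \<open>S\<close> is the union of \<open>Q\<close> and \<open>E\<close> is the relation of lying in the same member of \<open>Q\<close>.
  The elementary extensions are taken on the type \<open>'a + 'f + 'r + nat\<close>: it is infinite and at least
  as large as the structure and its language, so by the downward Loewenheim-Skolem theorem larger
  extensions would not give more.\<close>

definition rank_ge :: "('a, 'f, 'r) fo_structure \<Rightarrow> nat \<Rightarrow> 'a list set set \<Rightarrow> nat \<Rightarrow> bool" where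
  "rank_ge M k Q n \<longleftrightarrow>
     (\<exists>E S (N :: ('a + 'f + 'r + nat, 'f, 'r) fo_structure) h.
        params_in M S \<and> defined_set M k S = \<Union>Q \<and>
        params_in M E \<and> defined_set M (2 * k) E = {x @ y | x y. \<exists>C\<in>Q. x \<in> C \<and> y \<in> C} \<and>
        elementary_embedding M N h \<and> morley_ge n N k (transport h E) (transport h S))"

definition finite_rank :: "('a, 'f, 'r) fo_structure \<Rightarrow> nat \<Rightarrow> 'a list set set \<Rightarrow> bool" where
  "finite_rank M k Q \<longleftrightarrow> (\<exists>n. \<not> rank_ge M k Q n)"

text \<open>This is the Morley rank for interpretable sets of finite rank only; the empty set has
  rank \<open>-1\<close>.\<close>

definition rk :: "('a, 'f, 'r) fo_structure \<Rightarrow> nat \<Rightarrow> 'a list set set \<Rightarrow> int" where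
  "rk M k Q = int (LEAST n. \<not> rank_ge M k Q n) - 1"

text \<open>A definable set, regarded as its quotient by equality.\<close>

definition singletons :: "'a list set \<Rightarrow> 'a list set set" where
  "singletons S = (\<lambda>x. {x}) ` S"


section \<open>Groups of finite Morley rank\<close>

text \<open>\<open>G\<close> is a group of finite Morley rank, definable, as a set of \<open>k\<close>-tuples, in the ambient
  structure \<open>M\<close> of finite Morley rank.\<close>

definition fmr_group :: "('a, 'f, 'r) fo_structure \<Rightarrow> nat \<Rightarrow> 'a list monoid \<Rightarrow> bool" where
  "fmr_group M k G \<longleftrightarrow>
     is_structure M \<and> finite_rank M 1 (singletons (tuples M 1)) \<and>
     group G \<and> definable M k (carrier G) \<and>
     definable M (3 * k) {x @ y @ (x \<otimes>\<^bsub>G\<^esub> y) | x y. x \<in> carrier G \<and> y \<in> carrier G} \<and>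
     finite_rank M k (singletons (carrier G))"

definition definable_subgroup ::
    "('a, 'f, 'r) fo_structure \<Rightarrow> nat \<Rightarrow> 'a list monoid \<Rightarrow> 'a list set \<Rightarrow> bool" where
  "definable_subgroup M k G H \<longleftrightarrow> subgroup H G \<and> definable M k H"

definition connected_subgroup ::
    "('a, 'f, 'r) fo_structure \<Rightarrow> nat \<Rightarrow> 'a list monoid \<Rightarrow> 'a list set \<Rightarrow> bool" where
  "connected_subgroup M k G H \<longleftrightarrow>
     definable_subgroup M k G H \<and>
     (\<nexists>K. definable_subgroup M k G K \<and> K \<subset> H \<and> finite (rcosets\<^bsub>G\<lparr>carrier := H\<rparr>\<^esub> K))"

definition indecomposable ::
    "('a, 'f, 'r) fo_structure \<Rightarrow> nat \<Rightarrow> 'a list monoid \<Rightarrow> 'a list set \<Rightarrow> bool" where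
  "indecomposable M k G A \<longleftrightarrow>
     (\<nexists>A1 A2. definable_subgroup M k G A1 \<and> A1 \<subset> A \<and>
              definable_subgroup M k G A2 \<and> A2 \<subset> A \<and> A1 <#>\<^bsub>G\<^esub> A2 = A)"

definition definable_supplement ::
    "('a, 'f, 'r) fo_structure \<Rightarrow> nat \<Rightarrow> 'a list monoid \<Rightarrow> 'a list set \<Rightarrow> 'a list set \<Rightarrow> 'a list set
      \<Rightarrow> bool" where
  "definable_supplement M k G A B C \<longleftrightarrow>
     definable_subgroup M k G C \<and> C \<subset> A \<and> B <#>\<^bsub>G\<^esub> C = A"

definition radical_candidate ::
    "('a, 'f, 'r) fo_structure \<Rightarrow> nat \<Rightarrow> 'a list monoid \<Rightarrow> 'a list set \<Rightarrow> 'a list set \<Rightarrow> bool" where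
  "radical_candidate M k G A B \<longleftrightarrow>
     connected_subgroup M k G B \<and> B \<subset> A \<and> (\<nexists>C. definable_supplement M k G A B C)"

text \<open>Only meaningful for nontrivial definable abelian \<open>A\<close>.\<close>

definition radical ::
    "('a, 'f, 'r) fo_structure \<Rightarrow> nat \<Rightarrow> 'a list monoid \<Rightarrow> 'a list set \<Rightarrow> 'a list set" where
  "radical M k G A =
     (THE J. radical_candidate M k G A J \<and> (\<nexists>B. radical_candidate M k G A B \<and> J \<subset> B))"

definition radical_quotient ::
    "('a, 'f, 'r) fo_structure \<Rightarrow> nat \<Rightarrow> 'a list monoid \<Rightarrow> 'a list set \<Rightarrow> 'a list set monoid" where
  "radical_quotient M k G A = G\<lparr>carrier := A\<rparr> Mod radical M k G A"

definition reduced_rank ::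
    "('a, 'f, 'r) fo_structure \<Rightarrow> nat \<Rightarrow> 'a list monoid \<Rightarrow> 'a list set \<Rightarrow> int" where
  "reduced_rank M k G A = rk M k (carrier (radical_quotient M k G A))"

definition torsion_free :: "('a, 'm) monoid_scheme \<Rightarrow> bool" where
  "torsion_free Q \<longleftrightarrow>
     (\<forall>x\<in>carrier Q. \<forall>n::nat. n > 0 \<and> x [^]\<^bsub>Q\<^esub> n = \<one>\<^bsub>Q\<^esub> \<longrightarrow> x = \<one>\<^bsub>Q\<^esub>)"

text \<open>\<open>U0 M k G r H\<close> is the subgroup \<open>U\<^sub>0\<^sub>,\<^sub>r(H)\<close> for a definable subgroup \<open>H\<close> of \<open>G\<close>.\<close>

definition U0 ::
    "('a, 'f, 'r) fo_structure \<Rightarrow> nat \<Rightarrow> 'a list monoid \<Rightarrow> int \<Rightarrow> 'a list set \<Rightarrow> 'a list set" where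
  "U0 M k G r H =
     generate G (\<Union>{A. definable_subgroup M k G A \<and> A \<subseteq> H \<and> A \<noteq> {\<one>\<^bsub>G\<^esub>} \<and>
                       comm_group (G\<lparr>carrier := A\<rparr>) \<and> indecomposable M k G A \<and>
                       reduced_rank M k G A = r \<and> torsion_free (radical_quotient M k G A)})"

definition U0_group :: "('a, 'f, 'r) fo_structure \<Rightarrow> nat \<Rightarrow> 'a list monoid \<Rightarrow> int \<Rightarrow> bool" where
  "U0_group M k G r \<longleftrightarrow> fmr_group M k G \<and> U0 M k G r (carrier G) = carrier G"

primrec lower_central :: "('a, 'm) monoid_scheme \<Rightarrow> nat \<Rightarrow> 'a set" where
  "lower_central G 0 = carrier G"
| "lower_central G (Suc n) =
     generate G {x \<otimes>\<^bsub>G\<^esub> y \<otimes>\<^bsub>G\<^esub> inv\<^bsub>G\<^esub> x \<otimes>\<^bsub>G\<^esub> inv\<^bsub>G\<^esub> y | x y.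
                   x \<in> lower_central G n \<and> y \<in> carrier G}"

definition nilpotent :: "('a, 'm) monoid_scheme \<Rightarrow> bool" where
  "nilpotent G \<longleftrightarrow> (\<exists>n. lower_central G n = {\<one>\<^bsub>G\<^esub>})"

end

theory Submission
  imports Defs
begin

text \<open>Call an abelian subgroup as in the definition of \<open>U\<^sub>0\<^sub>,\<^sub>r\<close> a generator, and let \<open>K\<close> be the subgroup
  generated by all generators that lie in some \<open>H i\<close>. Suppose \<open>K\<close> is proper.

  The shape of a generator \<open>A\<close> with radical \<open>J\<close> is decisive. A proper definable subgroup of \<open>A\<close> has its
  connected component inside \<open>J\<close>, and since \<open>A/J\<close> is torsion-free the whole subgroup lies in \<open>J\<close>: so \<open>J\<close>
  is the largest proper definable subgroup of \<open>A\<close>, and \<open>A\<close> is connected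
  (\<open>radical_is_largest_proper\<close>). Conversely, an abelian group that has a largest proper
  definable subgroup \<open>J\<close> with torsion-free quotient is indecomposable with radical \<open>J\<close>
  (\<open>largest_proper_is_radical\<close>).

  A subgroup generated by connected definable subgroups of a nilpotent group of finite Morley rank is
  itself definable and connected. Here this follows from the normalizer condition
  and the ascending chain condition: a connected definable subgroup that is maximal among the proper ones of a group \<open>W\<close> is normal
  in \<open>W\<close>, since its conjugates under the normalizer of its normalizer can be multiplied with it
  (\<open>proper_connected_cosubgroup\<close>). So \<open>K\<close> is definable and connected, and the same lemma, applied to \<open>G\<close>
  above \<open>K\<close>, gives a proper definable normal subgroup \<open>N\<close> containing \<open>K\<close> and a generator \<open>A\<close> with
  \<open>N A = G\<close>. Thus \<open>G/N\<close> is a definable image of \<open>A\<close>, and \<open>P = N J\<close> is a proper subgroup with \<open>G/P \<cong> A/J\<close>.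

  As the \<open>H i\<close> generate \<open>G\<close>, some \<open>H i\<close> has an element \<open>h\<close> outside \<open>P\<close>. Among the definable abelian
  subgroups of \<open>H i\<close> not contained in \<open>P\<close> (the centre of the centralizer of \<open>h\<close>, cut down to \<open>H i\<close>,
  provides one) take
  a minimal one, \<open>B\<close>. By minimality \<open>B \<inter> P\<close> is its largest proper definable subgroup, and \<open>B/(B \<inter> P)\<close> is
  definably isomorphic to \<open>G/P\<close>, hence torsion-free of rank \<open>r\<close>. So \<open>B\<close> is a generator inside \<open>H i\<close>
  that is not contained in \<open>N \<supseteq> K\<close> (\<open>pull_back\<close>), a contradiction.

  From model theory this uses only the chain conditions (descending for definable subgroups, ascending for
  connected ones) and the invariance of the rank of \<open>A/J\<close> under definable bijections. Both rest on
  one fact, \<open>morley_ge_embedding\<close>: a definable injection between interpretable sets does not decrease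
  Morley rank. Its proof moves first-order statements to elementary extensions; to avoid writing
  formulas, this is done for pairs of predicates defined by a common formula in both structures.\<close>

section \<open>Renaming variables in formulas\<close>

primrec trm_vars :: "'f trm \<Rightarrow> nat set" where
  "trm_vars (Var v) = {v}"
| "trm_vars (App f ts) = \<Union> (set (map trm_vars ts))"

primrec free_vars :: "('f, 'r) form \<Rightarrow> nat set" where
  "free_vars (Eq t u) = trm_vars t \<union> trm_vars u"
| "free_vars (Rel R ts) = \<Union> (trm_vars ` set ts)"
| "free_vars (Neg \<phi>) = free_vars \<phi>"
| "free_vars (Conj \<phi> \<psi>) = free_vars \<phi> \<union> free_vars \<psi>"
| "free_vars (Exists v \<phi>) = free_vars \<phi> - {v}"

lemma finite_trm_vars: "finite (trm_vars t)"
  by (induction t) auto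

lemma finite_free_vars: "finite (free_vars \<phi>)"
  by (induction \<phi>) (auto simp: finite_trm_vars)

lemma trm_val_cong: "(\<And>v. v \<in> trm_vars t \<Longrightarrow> s v = s' v) \<Longrightarrow> trm_val M s t = trm_val M s' t"
proof (induction t)
  case (App f ts)
  then have "map (trm_val M s) ts = map (trm_val M s') ts" by auto
  then show ?case by (simp del: map_eq_conv)
qed auto

lemma sat_cong: "(\<And>v. v \<in> free_vars \<phi> \<Longrightarrow> s v = s' v) \<Longrightarrow> sat M s \<phi> \<longleftrightarrow> sat M s' \<phi>"
proof (induction \<phi> arbitrary: s s')
  case (Eq t u)
  then show ?case by (simp add: trm_val_cong[of t s s'] trm_val_cong[of u s s'])
next
  case (Rel R ts)
  then have "map (trm_val M s) ts = map (trm_val M s') ts" by (auto intro: trm_val_cong)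
  then show ?case by (simp del: map_eq_conv)
next
  case (Neg \<phi>)
  have "sat M s \<phi> \<longleftrightarrow> sat M s' \<phi>" by (rule Neg.IH) (use Neg.prems in auto)
  then show ?case by simp
next
  case (Conj \<phi> \<psi>)
  have "sat M s \<phi> \<longleftrightarrow> sat M s' \<phi>" by (rule Conj.IH) (use Conj.prems in auto)
  moreover have "sat M s \<psi> \<longleftrightarrow> sat M s' \<psi>" by (rule Conj.IH) (use Conj.prems in auto)
  ultimately show ?case by simp
next
  case (Exists v \<phi>)
  have "sat M (s(v := a)) \<phi> \<longleftrightarrow> sat M (s'(v := a)) \<phi>" for a
    by (rule Exists.IH) (use Exists.prems in auto)
  then show ?case by simp
qed

primrec trm_rename :: "(nat \<Rightarrow> nat) \<Rightarrow> 'f trm \<Rightarrow> 'f trm" where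
  "trm_rename f (Var v) = Var (f v)"
| "trm_rename f (App g ts) = App g (map (trm_rename f) ts)"

text \<open>The bound variable is renamed to one outside the image of the free variables, so that \<open>f\<close> may
  identify variables.\<close>

primrec rename :: "(nat \<Rightarrow> nat) \<Rightarrow> ('f, 'r) form \<Rightarrow> ('f, 'r) form" where
  "rename f (Eq t u) = Eq (trm_rename f t) (trm_rename f u)"
| "rename f (Rel R ts) = Rel R (map (trm_rename f) ts)"
| "rename f (Neg \<phi>) = Neg (rename f \<phi>)"
| "rename f (Conj \<phi> \<psi>) = Conj (rename f \<phi>) (rename f \<psi>)"
| "rename f (Exists v \<phi>) =
     (let w = SOME w. w \<notin> f ` free_vars \<phi> in Exists w (rename (f(v := w)) \<phi>))"

lemma trm_val_rename: "trm_val M s (trm_rename f t) = trm_val M (s \<circ> f) t"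
proof (induction t)
  case (App g ts)
  then have "map (trm_val M s) (map (trm_rename f) ts) = map (trm_val M (s \<circ> f)) ts"
    by (auto simp: comp_def)
  then show ?case by (simp add: comp_def del: map_map map_eq_conv)
qed auto

lemma sat_rename: "sat M s (rename f \<phi>) \<longleftrightarrow> sat M (s \<circ> f) \<phi>"
proof (induction \<phi> arbitrary: s f)
  case (Eq t u)
  then show ?case by (simp add: trm_val_rename comp_def)
next
  case (Rel R ts)
  have "map (trm_val M s) (map (trm_rename f) ts) = map (trm_val M (s \<circ> f)) ts"
    by (auto simp: trm_val_rename)
  then show ?case by (simp add: comp_def del: map_map map_eq_conv)
next
  case (Exists v \<phi>)
  define w where "w = (SOME w. w \<notin> f ` free_vars \<phi>)"
  have w: "w \<notin> f ` free_vars \<phi>"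
    unfolding w_def by (rule someI_ex, rule ex_new_if_finite) (auto simp: finite_free_vars)
  have "sat M (s(w := a) \<circ> f(v := w)) \<phi> \<longleftrightarrow> sat M ((s \<circ> f)(v := a)) \<phi>" for a
    by (rule sat_cong) (use w in auto)
  then have "sat M (s(w := a)) (rename (f(v := w)) \<phi>) \<longleftrightarrow> sat M ((s \<circ> f)(v := a)) \<phi>" for a
    unfolding Exists.IH by blast
  then show ?case
    by (simp add: w_def[symmetric] Let_def comp_def del: fun_upd_apply)
qed auto

section \<open>Predicates defined by one formula in two structures\<close>

text \<open>Even variables carry the arguments of a predicate and odd variables its parameters. Parameters of
  several predicates can then be merged without touching the arguments.\<close>

definition mix :: "(nat \<Rightarrow> 'a) \<Rightarrow> (nat \<Rightarrow> 'a) \<Rightarrow> nat \<Rightarrow> 'a" where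
  "mix s c i = (if even i then s (i div 2) else c (i div 2))"

text \<open>The predicates \<open>q\<close> and \<open>q'\<close> are defined by the same formula, with parameters \<open>c\<close> in \<open>N\<close> and \<open>h \<circ> c\<close>
  in \<open>N'\<close>. Such pairs are closed under the first-order operations and agree along an elementary
  embedding \<open>h\<close>, so first-order statements can be transferred without exhibiting formulas. For \<open>N = N'\<close>,
  \<open>h = id\<close> and \<open>q = q'\<close> this is definability with parameters.\<close>

definition assignment_codefinable ::
    "('a, 'f, 'r) fo_structure \<Rightarrow> ('b, 'f, 'r) fo_structure \<Rightarrow> ('a \<Rightarrow> 'b) \<Rightarrow>
     ((nat \<Rightarrow> 'a) \<Rightarrow> bool) \<Rightarrow> ((nat \<Rightarrow> 'b) \<Rightarrow> bool) \<Rightarrow> bool" where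
  "assignment_codefinable N N' h q q' \<longleftrightarrow>
     (\<exists>\<phi> c. range c \<subseteq> univ N \<and>
        (\<forall>s. range s \<subseteq> univ N \<longrightarrow> q s = sat N (mix s c) \<phi>) \<and>
        (\<forall>s. range s \<subseteq> univ N' \<longrightarrow> q' s = sat N' (mix s (h \<circ> c)) \<phi>))"

lemma range_mix: "range s \<subseteq> A \<Longrightarrow> range c \<subseteq> A \<Longrightarrow> range (mix s c) \<subseteq> A"
  by (auto simp: mix_def)

lemma mix_upd: "mix (s(v := a)) c = (mix s c)(2 * v := a)"
  by (auto simp: mix_def fun_eq_iff)

lemma assignment_codefinable_cong:
  assumes "assignment_codefinable N N' h q q'" "\<And>s. range s \<subseteq> univ N \<Longrightarrow> q s = p s" "\<And>s. range s \<subseteq> univ N' \<Longrightarrow> q' s = p' s"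
  shows "assignment_codefinable N N' h p p'"
  using assms(1) unfolding assignment_codefinable_def by (simp add: assms(2,3) cong: imp_cong)

lemma assignment_codefinable_not: "assignment_codefinable N N' h q q' \<Longrightarrow> assignment_codefinable N N' h (\<lambda>s. \<not> q s) (\<lambda>s. \<not> q' s)"
  unfolding assignment_codefinable_def
  apply (elim exE)
  subgoal for \<phi> c by (rule exI[of _ "Neg \<phi>"], rule exI[of _ c]) simp
  done

lemma assignment_codefinable_conj:
  assumes "assignment_codefinable N N' h q q'" "assignment_codefinable N N' h p p'"
  shows "assignment_codefinable N N' h (\<lambda>s. q s \<and> p s) (\<lambda>s. q' s \<and> p' s)"
proof -
  obtain \<phi> c where 1: "range c \<subseteq> univ N"
    "\<And>s. range s \<subseteq> univ N \<Longrightarrow> q s = sat N (mix s c) \<phi>"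
    "\<And>s. range s \<subseteq> univ N' \<Longrightarrow> q' s = sat N' (mix s (h \<circ> c)) \<phi>"
    using assms(1) unfolding assignment_codefinable_def by metis
  obtain \<psi> d where 2: "range d \<subseteq> univ N"
    "\<And>s. range s \<subseteq> univ N \<Longrightarrow> p s = sat N (mix s d) \<psi>"
    "\<And>s. range s \<subseteq> univ N' \<Longrightarrow> p' s = sat N' (mix s (h \<circ> d)) \<psi>"
    using assms(2) unfolding assignment_codefinable_def by metis
  \<comment> \<open>The merged parameters \<open>mix c d\<close> interleave \<open>c\<close> and \<open>d\<close>, so the parameters of \<open>\<phi>\<close> and \<open>\<psi>\<close> move to
      even and odd positions among the odd variables.\<close>
  define f where "f i = (if even i then i else 2 * (2 * (i div 2)) + 1)" for i :: nat
  define g where "g i = (if even i then i else 2 * (2 * (i div 2) + 1) + 1)" for i :: nat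
  have f: "mix s (mix c d) \<circ> f = mix s c" and g: "mix s (mix c d) \<circ> g = mix s d" for s and c d :: "nat \<Rightarrow> 'x"
    by (auto simp: mix_def f_def g_def fun_eq_iff elim!: oddE)
  have hm: "h \<circ> mix c d = mix (h \<circ> c) (h \<circ> d)" by (auto simp: mix_def fun_eq_iff)
  show ?thesis unfolding assignment_codefinable_def
    apply (rule exI[of _ "Conj (rename f \<phi>) (rename g \<psi>)"], rule exI[of _ "mix c d"])
    apply (intro conjI allI impI)
    subgoal by (rule range_mix[OF 1(1) 2(1)])
    subgoal for s unfolding sat.simps sat_rename f g using 1(2)[of s] 2(2)[of s] by simp
    subgoal for s unfolding sat.simps sat_rename hm f g using 1(3)[of s] 2(3)[of s] by simp
    done
qed

lemma assignment_codefinable_ex: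
  assumes "assignment_codefinable N N' h q q'"
  shows "assignment_codefinable N N' h (\<lambda>s. \<exists>a\<in>univ N. q (s(v := a))) (\<lambda>s. \<exists>a\<in>univ N'. q' (s(v := a)))"
proof -
  obtain \<phi> c where 1: "range c \<subseteq> univ N"
    "\<And>s. range s \<subseteq> univ N \<Longrightarrow> q s = sat N (mix s c) \<phi>"
    "\<And>s. range s \<subseteq> univ N' \<Longrightarrow> q' s = sat N' (mix s (h \<circ> c)) \<phi>"
    using assms(1) unfolding assignment_codefinable_def by metis
  have r: "range (s(v := a)) \<subseteq> U" if "range s \<subseteq> U" "a \<in> U" for s :: "nat \<Rightarrow> 'x" and a U
    using that by auto
  show ?thesis unfolding assignment_codefinable_def
    apply (rule exI[of _ "Exists (2 * v) \<phi>"], rule exI[of _ c])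
    apply (intro conjI allI impI)
    subgoal by (rule 1)
    subgoal by (simp only: sat.simps mix_upd[symmetric]) (rule bex_cong[OF refl], rule 1(2), rule r)
    subgoal by (simp only: sat.simps mix_upd[symmetric]) (rule bex_cong[OF refl], rule 1(3), rule r)
    done
qed

lemma assignment_codefinable_exs:
  assumes "assignment_codefinable N N' h q q'"
  shows "assignment_codefinable N N' h (\<lambda>s. \<exists>s'. range s' \<subseteq> univ N \<and> (\<forall>i. i \<notin> set vs \<longrightarrow> s' i = s i) \<and> q s')
                       (\<lambda>s. \<exists>s'. range s' \<subseteq> univ N' \<and> (\<forall>i. i \<notin> set vs \<longrightarrow> s' i = s i) \<and> q' s')"
proof (induction vs)
  case Nil
  obtain \<phi> c where 1: "range c \<subseteq> univ N"
    "\<And>s. range s \<subseteq> univ N \<Longrightarrow> q s = sat N (mix s c) \<phi>"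
    "\<And>s. range s \<subseteq> univ N' \<Longrightarrow> q' s = sat N' (mix s (h \<circ> c)) \<phi>"
    using assms(1) unfolding assignment_codefinable_def by metis
  have *: "(\<exists>s'. range s' \<subseteq> U \<and> (\<forall>i. i \<notin> set [] \<longrightarrow> s' i = s i) \<and> P s') \<longleftrightarrow> P s"
    if "range s \<subseteq> U" for s :: "nat \<Rightarrow> 'x" and U P
  proof -
    have "(\<forall>i. i \<notin> set [] \<longrightarrow> s' i = s i) \<longleftrightarrow> s' = s" for s' by (simp add: fun_eq_iff)
    then show ?thesis using that by (simp only: ) simp
  qed
  show ?case unfolding assignment_codefinable_def
    apply (rule exI[of _ \<phi>], rule exI[of _ c], intro conjI allI impI)
    subgoal by (rule 1)
    subgoal for s using *[of s _ q] 1(2)[of s] by blast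
    subgoal for s using *[of s _ q'] 1(3)[of s] by blast
    done
next
  case (Cons v vs)
  have *: "(\<exists>a\<in>U. \<exists>s'. range s' \<subseteq> U \<and> (\<forall>i. i \<notin> set vs \<longrightarrow> s' i = (s(v := a)) i) \<and> P s') \<longleftrightarrow>
     (\<exists>s'. range s' \<subseteq> U \<and> (\<forall>i. i \<notin> set (v # vs) \<longrightarrow> s' i = s i) \<and> P s')" (is "?l \<longleftrightarrow> ?r")
    if "range s \<subseteq> U" for s :: "nat \<Rightarrow> 'x" and U P
  proof
    assume ?l
    then obtain a s' where s': "range s' \<subseteq> U" "\<forall>i. i \<notin> set vs \<longrightarrow> s' i = (s(v := a)) i" "P s'" by blast
    show ?r by (rule exI[of _ s']) (use s' in auto)
  next
    assume ?r
    then obtain s' where s': "range s' \<subseteq> U" "\<forall>i. i \<notin> set (v # vs) \<longrightarrow> s' i = s i" "P s'" by blast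
    have "s' i = (s(v := s' v)) i" if "i \<notin> set vs" for i using s'(2) that by (cases "i = v") auto
    moreover have "s' v \<in> U" using s'(1) by blast
    ultimately show ?l using s' by blast
  qed
  show ?case
    by (rule assignment_codefinable_cong[OF assignment_codefinable_ex[OF Cons.IH, of v]]; rule *; assumption)
qed

lemma assignment_codefinable_elementary:
  assumes "assignment_codefinable N N' h q q'" "elementary_embedding N N' h" "range s \<subseteq> univ N"
  shows "q' (h \<circ> s) \<longleftrightarrow> q s"
proof -
  obtain \<phi> c where 1: "range c \<subseteq> univ N"
    "\<And>s. range s \<subseteq> univ N \<Longrightarrow> q s = sat N (mix s c) \<phi>"
    "\<And>s. range s \<subseteq> univ N' \<Longrightarrow> q' s = sat N' (mix s (h \<circ> c)) \<phi>"
    using assms(1) unfolding assignment_codefinable_def by metis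
  have "range (h \<circ> s) \<subseteq> univ N'"
    using assms(2,3) unfolding elementary_embedding_def by auto
  moreover have "h \<circ> mix s c = mix (h \<circ> s) (h \<circ> c)" by (auto simp: mix_def fun_eq_iff)
  moreover have "sat N' (h \<circ> mix s c) \<phi> \<longleftrightarrow> sat N (mix s c) \<phi>"
    using assms(2) range_mix[OF assms(3) 1(1)] unfolding elementary_embedding_def by blast
  ultimately show ?thesis using 1 assms(3) by simp
qed

text \<open>A formula has finitely many free variables, so quantifying over all assignments amounts to
  quantifying over a finite list of variables, which leaves a sentence with parameters.\<close>

lemma assignment_codefinable_transfer_ex:
  fixes N :: "('a, 'f, 'r) fo_structure" and N' :: "('b, 'f, 'r) fo_structure"
  assumes q: "assignment_codefinable N N' h q q'" and h: "elementary_embedding N N' h"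
  shows "(\<exists>s. range s \<subseteq> univ N \<and> q s) \<longleftrightarrow> (\<exists>s. range s \<subseteq> univ N' \<and> q' s)"
proof -
  obtain \<phi> c where 1: "range c \<subseteq> univ N"
    "\<And>s. range s \<subseteq> univ N \<Longrightarrow> q s = sat N (mix s c) \<phi>"
    "\<And>s. range s \<subseteq> univ N' \<Longrightarrow> q' s = sat N' (mix s (h \<circ> c)) \<phi>"
    using q unfolding assignment_codefinable_def by metis
  obtain m where m: "\<And>v. v \<in> free_vars \<phi> \<Longrightarrow> v < m"
    using finite_free_vars[of \<phi>] finite_nat_set_iff_bounded by auto
  obtain a where a: "a \<in> univ N"
    using h unfolding elementary_embedding_def is_structure_def by auto
  define s0 where "s0 = (\<lambda>_::nat. a)"
  have s0: "range s0 \<subseteq> univ N" using a by (auto simp: s0_def)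
  have hs0: "range (h \<circ> s0) \<subseteq> univ N'"
    using h s0 unfolding elementary_embedding_def by auto
  have *: "(\<exists>s'. range s' \<subseteq> U \<and> (\<forall>i. i \<notin> set [0..<m] \<longrightarrow> s' i = t i) \<and> q s') \<longleftrightarrow> (\<exists>s. range s \<subseteq> U \<and> q s)"
    if t: "range t \<subseteq> U" and
    q: "\<And>s s'. range s \<subseteq> U \<Longrightarrow> range s' \<subseteq> U \<Longrightarrow> (\<And>i. i < m \<Longrightarrow> s i = s' i) \<Longrightarrow> q s \<Longrightarrow> q s'"
    for U and q :: "(nat \<Rightarrow> 'x) \<Rightarrow> bool" and t
  proof
    assume "\<exists>s. range s \<subseteq> U \<and> q s"
    then obtain s where s: "range s \<subseteq> U" "q s" by blast
    let ?s = "\<lambda>i. if i < m then s i else t i"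
    have r: "range ?s \<subseteq> U" using s t by auto
    have "q ?s" by (rule q[OF s(1) r _ s(2)]) simp
    then show "\<exists>s'. range s' \<subseteq> U \<and> (\<forall>i. i \<notin> set [0..<m] \<longrightarrow> s' i = t i) \<and> q s'"
      using r by (intro exI[of _ ?s]) simp
  qed blast
  have ag: "sat L (mix s d) \<phi> \<longleftrightarrow> sat L (mix s' d) \<phi>" if "\<And>i. i < m \<Longrightarrow> s i = s' i"
    for L :: "('x, 'f, 'r) fo_structure" and s s' d
  proof (rule sat_cong)
    fix v assume "v \<in> free_vars \<phi>"
    then have "v div 2 < m" using m[of v] by simp
    then show "mix s d v = mix s' d v" using that by (simp add: mix_def)
  qed
  have "(\<exists>s'. range s' \<subseteq> univ N' \<and> (\<forall>i. i \<notin> set [0..<m] \<longrightarrow> s' i = (h \<circ> s0) i) \<and> q' s') \<longleftrightarrow>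
    (\<exists>s'. range s' \<subseteq> univ N \<and> (\<forall>i. i \<notin> set [0..<m] \<longrightarrow> s' i = s0 i) \<and> q s')"
    by (rule assignment_codefinable_elementary[OF assignment_codefinable_exs[OF q] h s0])
  also have "\<dots> \<longleftrightarrow> (\<exists>s. range s \<subseteq> univ N \<and> q s)"
  proof (rule *[OF s0])
    fix s s' :: "nat \<Rightarrow> 'a"
    assume "range s \<subseteq> univ N" "range s' \<subseteq> univ N" "\<And>i. i < m \<Longrightarrow> s i = s' i" "q s"
    then show "q s'" using ag[of s s' N c] by (simp add: 1)
  qed
  also have "(\<exists>s'. range s' \<subseteq> univ N' \<and> (\<forall>i. i \<notin> set [0..<m] \<longrightarrow> s' i = (h \<circ> s0) i) \<and> q' s') \<longleftrightarrow>
      (\<exists>s. range s \<subseteq> univ N' \<and> q' s)"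
  proof (rule *[OF hs0])
    fix s s' :: "nat \<Rightarrow> 'b"
    assume "range s \<subseteq> univ N'" "range s' \<subseteq> univ N'" "\<And>i. i < m \<Longrightarrow> s i = s' i" "q' s"
    then show "q' s'" using ag[of s s' N' "h \<circ> c"] by (simp add: 1)
  qed
  finally show ?thesis by blast
qed

text \<open>The variables \<open>b * k, \<dots>, b * k + k - 1\<close> form the \<open>b\<close>-th tuple of an assignment. Predicates
  on tuples are written as predicates of \<open>V\<close>, where \<open>V b\<close> is the \<open>b\<close>-th tuple.\<close>

definition blocks :: "nat \<Rightarrow> (nat \<Rightarrow> 'a) \<Rightarrow> nat \<Rightarrow> 'a list" where
  "blocks k s b = map (\<lambda>i. s (b * k + i)) [0..<k]"

definition tuple_val :: "('a, 'f, 'r) fo_structure \<Rightarrow> nat \<Rightarrow> (nat \<Rightarrow> 'a list) \<Rightarrow> bool" where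
  "tuple_val N k V \<longleftrightarrow> (\<forall>b. V b \<in> tuples N k)"

definition codefinable ::
    "('a, 'f, 'r) fo_structure \<Rightarrow> ('b, 'f, 'r) fo_structure \<Rightarrow> ('a \<Rightarrow> 'b) \<Rightarrow> nat \<Rightarrow>
     ((nat \<Rightarrow> 'a list) \<Rightarrow> bool) \<Rightarrow> ((nat \<Rightarrow> 'b list) \<Rightarrow> bool) \<Rightarrow> bool" where
  "codefinable N N' h k p p' \<longleftrightarrow> assignment_codefinable N N' h (\<lambda>s. p (blocks k s)) (\<lambda>s. p' (blocks k s))"

definition block_upd :: "nat \<Rightarrow> (nat \<Rightarrow> 'a) \<Rightarrow> nat \<Rightarrow> 'a list \<Rightarrow> nat \<Rightarrow> 'a" where
  "block_upd k s b x i = (if b * k \<le> i \<and> i < b * k + k then x ! (i - b * k) else s i)"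

lemma length_blocks [simp]: "length (blocks k s b) = k"
  by (simp add: blocks_def)

lemma blocks_in_tuples: "range s \<subseteq> univ N \<Longrightarrow> blocks k s b \<in> tuples N k"
  by (auto simp: blocks_def tuples_def)

lemma tuple_val_blocks: "range s \<subseteq> univ N \<Longrightarrow> tuple_val N k (blocks k s)"
  by (simp add: tuple_val_def blocks_in_tuples)

lemma block_disjoint:
  fixes b b' k i :: nat
  assumes "b \<noteq> b'" "i < k"
  shows "\<not> (b' * k \<le> b * k + i \<and> b * k + i < b' * k + k)"
proof (cases "b < b'")
  case True
  then have "Suc b * k \<le> b' * k" by (intro mult_le_mono1) simp
  then show ?thesis using assms by simp
next
  case False
  then have "Suc b' * k \<le> b * k" using assms by (intro mult_le_mono1) simp
  then show ?thesis using assms by simp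
qed

lemma blocks_block_upd:
  assumes "length x = k"
  shows "blocks k (block_upd k s b x) = (blocks k s)(b := x)"
proof
  fix b'
  show "blocks k (block_upd k s b x) b' = ((blocks k s)(b := x)) b'"
  proof (cases "b' = b")
    case True
    then show ?thesis using assms by (auto simp: blocks_def block_upd_def intro!: nth_equalityI)
  next
    case False
    then show ?thesis using block_disjoint[of b' b _ k] by (auto simp: blocks_def block_upd_def)
  qed
qed

lemma range_block_upd:
  assumes "range s \<subseteq> univ N" "x \<in> tuples N k"
  shows "range (block_upd k s b x) \<subseteq> univ N"
proof -
  have "block_upd k s b x i \<in> univ N" for i
  proof (cases "b * k \<le> i \<and> i < b * k + k")
    case True
    then have "x ! (i - b * k) \<in> set x" using assms(2) by (intro nth_mem) (auto simp: tuples_def)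
    then show ?thesis using True assms(2) by (auto simp: block_upd_def tuples_def)
  next
    case False
    then show ?thesis using assms(1) by (auto simp: block_upd_def)
  qed
  then show ?thesis by blast
qed

lemma tuple_val_obtain:
  assumes "tuple_val N k V" "univ N \<noteq> {}"
  obtains s where "range s \<subseteq> univ N" "blocks k s = V"
proof -
  obtain a where a: "a \<in> univ N" using assms(2) by blast
  define s where "s i = (if k = 0 then a else V (i div k) ! (i mod k))" for i
  have V: "length (V b) = k" "set (V b) \<subseteq> univ N" for b
    using assms(1) by (auto simp: tuple_val_def tuples_def)
  have "s i \<in> univ N" for i
  proof (cases "k = 0")
    case False
    then have "V (i div k) ! (i mod k) \<in> set (V (i div k))" by (intro nth_mem) (simp add: V)
    then show ?thesis using False V(2)[of "i div k"] by (auto simp: s_def)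
  qed (simp add: s_def a)
  moreover have "blocks k s b = V b" for b
    by (rule nth_equalityI) (auto simp: V blocks_def s_def)
  ultimately show ?thesis using that by blast
qed

lemma codefinable_cong:
  assumes "codefinable N N' h k p p'" "\<And>V. tuple_val N k V \<Longrightarrow> p V = r V" "\<And>V. tuple_val N' k V \<Longrightarrow> p' V = r' V"
  shows "codefinable N N' h k r r'"
  unfolding codefinable_def
  by (rule assignment_codefinable_cong[OF assms(1)[unfolded codefinable_def]]) (simp_all add: assms(2,3) tuple_val_blocks)

lemma codefinable_not: "codefinable N N' h k p p' \<Longrightarrow> codefinable N N' h k (\<lambda>V. \<not> p V) (\<lambda>V. \<not> p' V)"
  unfolding codefinable_def by (rule assignment_codefinable_not)

lemma codefinable_conj:
  "codefinable N N' h k p p' \<Longrightarrow> codefinable N N' h k q q' \<Longrightarrow> codefinable N N' h k (\<lambda>V. p V \<and> q V) (\<lambda>V. p' V \<and> q' V)"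
  unfolding codefinable_def by (rule assignment_codefinable_conj)

lemma codefinable_imp:
  "codefinable N N' h k p p' \<Longrightarrow> codefinable N N' h k q q' \<Longrightarrow> codefinable N N' h k (\<lambda>V. p V \<longrightarrow> q V) (\<lambda>V. p' V \<longrightarrow> q' V)"
  using codefinable_not[OF codefinable_conj[OF _ codefinable_not]] by (rule codefinable_cong) auto

lemma codefinable_ex:
  assumes "codefinable N N' h k p p'"
  shows "codefinable N N' h k (\<lambda>V. \<exists>x\<in>tuples N k. p (V(b := x))) (\<lambda>V. \<exists>x\<in>tuples N' k. p' (V(b := x)))"
proof -
  have *: "(\<exists>s'. range s' \<subseteq> univ L \<and> (\<forall>i. i \<notin> set [b * k..<b * k + k] \<longrightarrow> s' i = s i) \<and> q (blocks k s')) \<longleftrightarrow>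
     (\<exists>x\<in>tuples L k. q ((blocks k s)(b := x)))" (is "?l \<longleftrightarrow> ?r") if s: "range s \<subseteq> univ L"
    for s and L :: "('x, 'y, 'z) fo_structure" and q
  proof
    assume ?l
    then obtain s' where s'0: "range s' \<subseteq> univ L \<and> (\<forall>i. i \<notin> set [b * k..<b * k + k] \<longrightarrow> s' i = s i) \<and> q (blocks k s')"
      by (rule exE)
    note s' = s'0[THEN conjunct1] s'0[THEN conjunct2, THEN conjunct1] s'0[THEN conjunct2, THEN conjunct2]
    have "blocks k s' b' = blocks k s b'" if "b' \<noteq> b" for b'
    proof -
      have "s' (b' * k + i) = s (b' * k + i)" if "i < k" for i
        using s'(2) block_disjoint[OF \<open>b' \<noteq> b\<close> that] by simp
      then show ?thesis by (simp add: blocks_def)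
    qed
    then have "blocks k s' = (blocks k s)(b := blocks k s' b)" by auto
    then have "q ((blocks k s)(b := blocks k s' b))" using s'(3) by simp
    then show ?r by (rule bexI) (rule blocks_in_tuples[OF s'(1)])
  next
    assume ?r
    then obtain x where x: "x \<in> tuples L k" "q ((blocks k s)(b := x))" by blast
    then have "q (blocks k (block_upd k s b x))" by (simp add: blocks_block_upd tuples_def)
    then show ?l using range_block_upd[OF s x(1), of b]
      by (intro exI[of _ "block_upd k s b x"]) (auto simp: block_upd_def)
  qed
  show ?thesis unfolding codefinable_def
    by (rule assignment_codefinable_cong[OF assignment_codefinable_exs[OF assms[unfolded codefinable_def], of "[b * k..<b * k + k]"]]; rule *; assumption)
qed

lemma codefinable_all:
  assumes "codefinable N N' h k p p'"
  shows "codefinable N N' h k (\<lambda>V. \<forall>x\<in>tuples N k. p (V(b := x))) (\<lambda>V. \<forall>x\<in>tuples N' k. p' (V(b := x)))"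
  using codefinable_not[OF codefinable_ex[OF codefinable_not[OF assms]]] by (rule codefinable_cong) auto

lemma nth_concat_blocks:
  assumes "\<And>b. b \<in> set bs \<Longrightarrow> length (V b) = k" "i < length bs * k"
  shows "concat (map V bs) ! i = V (bs ! (i div k)) ! (i mod k)"
  using assms
proof (induction bs arbitrary: i)
  case (Cons b bs)
  show ?case
  proof (cases "i < k")
    case True
    then show ?thesis using Cons.prems(1)[of b] by (simp add: nth_append)
  next
    case False
    have k: "k > 0" using Cons.prems by (cases k) auto
    have "concat (map V bs) ! (i - k) = V (bs ! ((i - k) div k)) ! ((i - k) mod k)"
      by (rule Cons.IH) (use Cons.prems False in auto)
    moreover have "i div k = Suc ((i - k) div k)" "i mod k = (i - k) mod k"
      using False k by (simp_all add: le_div_geq le_mod_geq)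
    ultimately show ?thesis using False Cons.prems(1)[of b] by (simp add: nth_append)
  qed
qed simp

lemma concat_blocks_in_tuples:
  assumes "tuple_val N k V"
  shows "concat (map V bs) \<in> tuples N (length bs * k)"
proof (induction bs)
  case (Cons b bs)
  moreover have "V b \<in> tuples N k" using assms by (simp add: tuple_val_def)
  ultimately show ?case by (simp add: tuples_def)
qed (simp add: tuples_def)

lemma codefinable_defined_set:
  assumes P: "params_in N P" and m: "m = length bs * k"
  shows "codefinable N N' h k (\<lambda>V. concat (map V bs) \<in> defined_set N m P)
           (\<lambda>V. concat (map V bs) \<in> defined_set N' m (transport h P))"
proof -
  define f where "f i = (if i < m then 2 * (bs ! (i div k) * k + i mod k) else 2 * i + 1)" for i
  have *: "mix s c \<circ> f = (\<lambda>i. if i < m then concat (map (blocks k s) bs) ! i else c i)"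
    for s c :: "nat \<Rightarrow> 'x"
  proof
    fix i
    show "(mix s c \<circ> f) i = (if i < m then concat (map (blocks k s) bs) ! i else c i)"
    proof (cases "i < m")
      case True
      then have "0 < k" using m by (cases k) auto
      then show ?thesis using True m by (simp add: nth_concat_blocks mix_def f_def) (simp add: blocks_def)
    next
      case False
      then show ?thesis by (simp add: mix_def f_def)
    qed
  qed
  show ?thesis unfolding codefinable_def assignment_codefinable_def
    apply (rule exI[of _ "rename f (fst P)"], rule exI[of _ "snd P"], intro conjI allI impI)
    subgoal using P by (simp add: params_in_def)
    subgoal for s using concat_blocks_in_tuples[OF tuple_val_blocks[of s N k], of bs]
      unfolding sat_rename * by (simp add: defined_set_def m)
    subgoal for s using concat_blocks_in_tuples[OF tuple_val_blocks[of s N' k], of bs]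
      unfolding sat_rename * by (simp add: defined_set_def m transport_def cong: if_cong)
    done
qed

text \<open>Substituting a fixed tuple \<open>g\<close> turns the variables of block \<open>b\<close> into parameters: the entries of \<open>g\<close> are
  put in front of the old ones.\<close>

lemma codefinable_const:
  assumes p: "codefinable N N' h k p p'" and g: "g \<in> tuples N k"
    and h: "h ` univ N \<subseteq> univ N'"
  shows "codefinable N N' h k (\<lambda>V. p (V(b := g))) (\<lambda>V. p' (V(b := map h g)))"
proof -
  obtain \<phi> c where 1: "range c \<subseteq> univ N"
    "\<And>s. range s \<subseteq> univ N \<Longrightarrow> p (blocks k s) = sat N (mix s c) \<phi>"
    "\<And>s. range s \<subseteq> univ N' \<Longrightarrow> p' (blocks k s) = sat N' (mix s (h \<circ> c)) \<phi>"
    using p unfolding codefinable_def assignment_codefinable_def by metis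
  define c' where "c' i = (if i < k then g ! i else c (i - k))" for i
  define f where "f i = (if even i then
      (if b * k \<le> i div 2 \<and> i div 2 < b * k + k then 2 * (i div 2 - b * k) + 1 else i)
      else 2 * (i div 2 + k) + 1)" for i
  have g': "length g = k" "set g \<subseteq> univ N" using g by (auto simp: tuples_def)
  have c': "range c' \<subseteq> univ N"
    using 1(1) g' by (auto simp: c'_def subset_iff)
  have N: "mix s c' \<circ> f = mix (block_upd k s b g) c" for s
    by (rule ext) (auto simp: mix_def f_def c'_def block_upd_def elim!: oddE)
  have N': "mix s (h \<circ> c') \<circ> f = mix (block_upd k s b (map h g)) (h \<circ> c)" for s
    by (rule ext) (auto simp: mix_def f_def c'_def block_upd_def g' elim!: oddE)
  have "map h g \<in> tuples N' k" using g h by (auto simp: tuples_def)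
  then have r: "range (block_upd k s b (map h g)) \<subseteq> univ N'" if "range s \<subseteq> univ N'" for s
    using that range_block_upd by blast
  show ?thesis unfolding codefinable_def assignment_codefinable_def
    apply (rule exI[of _ "rename f \<phi>"], rule exI[of _ c'], intro conjI allI impI)
    subgoal by (rule c')
    subgoal for s unfolding sat_rename N using 1(2)[OF range_block_upd[OF _ g], of s b]
      by (simp add: blocks_block_upd g')
    subgoal for s unfolding sat_rename N' using 1(3)[OF r, of s]
      by (simp add: blocks_block_upd g')
    done
qed

text \<open>The way back from predicates to sets of \<open>j * k\<close>-tuples. The map \<open>g\<close> tells which of the \<open>j\<close>
  subtuples is read for block \<open>b\<close>; the coordinates become the variables below \<open>j * k\<close> and the parameters
  are moved behind them.\<close>

lemma codefinable_pform:
  assumes p: "codefinable N N id k p p" and g: "\<And>b. g b < j"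
  obtains P where "params_in N P"
    "defined_set N (j * k) P = {xs \<in> tuples N (j * k). p (\<lambda>b. take k (drop (g b * k) xs))}"
proof -
  obtain \<phi> c where 1: "range c \<subseteq> univ N"
    "\<And>s. range s \<subseteq> univ N \<Longrightarrow> p (blocks k s) = sat N (mix s c) \<phi>"
    using p unfolding codefinable_def assignment_codefinable_def by metis
  define f where "f i = (if even i then
      \<comment> \<open>For \<open>k = 0\<close> every block is the empty tuple, and the value here is arbitrary.\<close>
      (if k = 0 then 0 else g (i div 2 div k) * k + i div 2 mod k) else j * k + i div 2)" for i
  define d where "d i = c (i - j * k)" for i
  define P where "P = (rename f \<phi>, d)"
  have "params_in N P" using 1(1) by (auto simp: params_in_def P_def d_def)
  moreover have "sat N (\<lambda>i. if i < j * k then xs ! i else d i) (rename f \<phi>) \<longleftrightarrow>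
      p (\<lambda>b. take k (drop (g b * k) xs))" if xs: "xs \<in> tuples N (j * k)" for xs
  proof -
    define \<sigma> where "\<sigma> i = (if i < j * k then xs ! i else d i)" for i
    define s where "s i = \<sigma> (f (2 * i))" for i
    have s: "range s \<subseteq> univ N"
      using xs 1(1) by (auto simp: s_def \<sigma>_def tuples_def d_def subset_iff)
    have "\<sigma> \<circ> f = mix s c"
      by (rule ext) (auto simp: mix_def s_def f_def \<sigma>_def d_def elim!: oddE)
    moreover have "blocks k s = (\<lambda>b. take k (drop (g b * k) xs))"
    proof
      fix b
      have "Suc (g b) * k \<le> j * k" using g[of b] by (intro mult_le_mono1) simp
      then have le: "g b * k + k \<le> j * k" by simp
      then have le': "g b * k \<le> j * k" by linarith
      show "blocks k s b = take k (drop (g b * k) xs)"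
        by (rule nth_equalityI)
           (use le le' xs in \<open>auto simp: blocks_def s_def f_def \<sigma>_def tuples_def\<close>)
    qed
    ultimately show ?thesis
      using 1(2)[OF s] by (simp add: sat_rename \<sigma>_def[abs_def, symmetric])
  qed
  ultimately show ?thesis
    by (intro that[of P]) (auto simp: defined_set_def P_def cong: if_cong)
qed

lemma codefinable_pform1:
  assumes p: "codefinable N N id k p p"
  obtains P where "params_in N P" "defined_set N k P = {x \<in> tuples N k. p (\<lambda>_. x)}"
proof -
  obtain P where P: "params_in N P"
    "defined_set N (1 * k) P = {xs \<in> tuples N (1 * k). p (\<lambda>b. take k (drop (0 * k) xs))}"
    using codefinable_pform[OF p, of "\<lambda>_. 0" 1] by auto
  show ?thesis by (rule that[OF P(1)]) (use P(2) in \<open>auto simp: tuples_def\<close>)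
qed

lemma codefinable_pform2:
  assumes p: "codefinable N N id k p p"
  obtains P where "params_in N P"
    "defined_set N (2 * k) P = {x @ y | x y. x \<in> tuples N k \<and> y \<in> tuples N k \<and> p (\<lambda>b. if b = 0 then x else y)}"
proof -
  define g where "g b = (if b = 0 then 0 else 1 :: nat)" for b :: nat
  obtain P where P: "params_in N P"
    "defined_set N (2 * k) P = {xs \<in> tuples N (2 * k). p (\<lambda>b. take k (drop (g b * k) xs))}"
    by (rule codefinable_pform[OF p, of g 2]) (simp add: g_def)
  have 1: "(\<lambda>b. take k (drop (g b * k) (x @ y))) = (\<lambda>b. if b = 0 then x else y)"
    if "x \<in> tuples N k" "y \<in> tuples N k" for x y
    using that by (auto simp: g_def tuples_def fun_eq_iff)
  have 2: "\<exists>x y. xs = x @ y \<and> x \<in> tuples N k \<and> y \<in> tuples N k" if "xs \<in> tuples N (2 * k)" for xs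
    by (rule exI[of _ "take k xs"], rule exI[of _ "drop k xs"])
       (use that in \<open>auto simp: tuples_def dest: in_set_takeD in_set_dropD\<close>)
  have 3: "x @ y \<in> tuples N (2 * k)" if "x \<in> tuples N k" "y \<in> tuples N k" for x y
    using that by (auto simp: tuples_def)
  show ?thesis
  proof (rule that[OF P(1)], unfold P(2), safe)
    fix xs assume xs: "xs \<in> tuples N (2 * k)" "p (\<lambda>b. take k (drop (g b * k) xs))"
    then obtain x y where xy: "xs = x @ y" "x \<in> tuples N k" "y \<in> tuples N k" using 2 by blast
    then have "p (\<lambda>b. if b = 0 then x else y)" using xs(2) 1[OF xy(2,3)] by simp
    then show "\<exists>x y. xs = x @ y \<and> x \<in> tuples N k \<and> y \<in> tuples N k \<and> p (\<lambda>b. if b = 0 then x else y)"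
      using xy by blast
  qed (simp_all add: 1 3 del: take_append drop_append)
qed

lemma codefinable_transfer_all:
  assumes p: "codefinable N N' h k p p'" and h: "elementary_embedding N N' h"
    and "\<And>V. tuple_val N k V \<Longrightarrow> p V" and V: "tuple_val N' k V"
  shows "p' V"
proof (rule ccontr)
  assume np: "\<not> p' V"
  have "univ N' \<noteq> {}" using h unfolding elementary_embedding_def is_structure_def by blast
  then obtain s where s: "range s \<subseteq> univ N'" "blocks k s = V" using tuple_val_obtain[OF V] by blast
  have "(\<exists>s. range s \<subseteq> univ N \<and> \<not> p (blocks k s)) \<longleftrightarrow> (\<exists>s. range s \<subseteq> univ N' \<and> \<not> p' (blocks k s))"
    using assignment_codefinable_transfer_ex[OF assignment_codefinable_not[OF p[unfolded codefinable_def]] h] .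
  then have "\<exists>s. range s \<subseteq> univ N \<and> \<not> p (blocks k s)"
    using s np by (metis (no_types))
  then show False using assms(3) tuple_val_blocks by blast
qed

section \<open>Morley rank and embeddings of interpretable sets\<close>

lemma transport_id [simp]: "transport id P = P"
  by (simp add: transport_def)

lemma defined_set_tuples: "x \<in> defined_set N m P \<Longrightarrow> x \<in> tuples N m"
  by (simp add: defined_set_def)

lemma codefinable_mem:
  "params_in N P \<Longrightarrow> codefinable N N' h k (\<lambda>V. V b \<in> defined_set N k P) (\<lambda>V. V b \<in> defined_set N' k (transport h P))"
  using codefinable_defined_set[of N P k "[b]" k N' h] by simp

lemma codefinable_pair:
  "params_in N P \<Longrightarrow> codefinable N N' h k (\<lambda>V. V a @ V b \<in> defined_set N (2 * k) P)
     (\<lambda>V. V a @ V b \<in> defined_set N' (2 * k) (transport h P))"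
  using codefinable_defined_set[of N P "2 * k" "[a, b]" k N' h] by simp

text \<open>A definable injection of \<open>S/E\<close> into \<open>S'/E'\<close>, as a relation between representatives: \<open>T\<close> relates every element of
  \<open>S\<close> to a nonempty \<open>E'\<close>-saturated set of elements of \<open>S'\<close>, and elements of \<open>S\<close> related to a common
  element are \<open>E\<close>-equivalent. Every clause is guarded by membership in \<open>S\<close>, so that the same \<open>T\<close> serves
  when \<open>S\<close> is replaced by a subset.\<close>

definition quotient_embedding ::
    "('a, 'f, 'r) fo_structure \<Rightarrow> nat \<Rightarrow> ('a, 'f, 'r) pform \<Rightarrow> ('a, 'f, 'r) pform \<Rightarrow> ('a, 'f, 'r) pform \<Rightarrow>
     ('a, 'f, 'r) pform \<Rightarrow> ('a, 'f, 'r) pform \<Rightarrow> bool" where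
  "quotient_embedding N k E S E' S' T \<longleftrightarrow>
     (\<forall>x\<in>tuples N k. \<forall>y\<in>tuples N k.
        x \<in> defined_set N k S \<and> x @ y \<in> defined_set N (2 * k) T \<longrightarrow> y \<in> defined_set N k S') \<and>
     (\<forall>x\<in>tuples N k. x \<in> defined_set N k S \<longrightarrow> (\<exists>y\<in>tuples N k. x @ y \<in> defined_set N (2 * k) T)) \<and>
     (\<forall>x\<in>tuples N k. \<forall>y\<in>tuples N k. \<forall>z\<in>tuples N k.
        x \<in> defined_set N k S \<and> x @ y \<in> defined_set N (2 * k) T \<and> y @ z \<in> defined_set N (2 * k) E' \<longrightarrow>
        x @ z \<in> defined_set N (2 * k) T) \<and>
     (\<forall>x\<in>tuples N k. \<forall>x'\<in>tuples N k. \<forall>y\<in>tuples N k.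
        x \<in> defined_set N k S \<and> x' \<in> defined_set N k S \<and>
        x @ y \<in> defined_set N (2 * k) T \<and> x' @ y \<in> defined_set N (2 * k) T \<longrightarrow>
        x @ x' \<in> defined_set N (2 * k) E)"

lemma tuple_val_three: "x \<in> tuples N k \<Longrightarrow> y \<in> tuples N k \<Longrightarrow> z \<in> tuples N k \<Longrightarrow>
    tuple_val N k (\<lambda>b. if b = 0 then x else if b = 1 then y else z)"
  by (simp add: tuple_val_def)

text \<open>Each clause says that a predicate holds for all tuples, and the predicates in \<open>N\<close> and \<open>N'\<close> are given by
  the same formula.\<close>

lemma quotient_embedding_transfer:
  assumes h: "elementary_embedding N N' h"
    and p: "params_in N E" "params_in N S" "params_in N E'" "params_in N S'" "params_in N T"
    and emb: "quotient_embedding N k E S E' S' T"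
  shows "quotient_embedding N' k (transport h E) (transport h S) (transport h E') (transport h S') (transport h T)"
proof -
  note e = emb[unfolded quotient_embedding_def]
  note e1 = e[THEN conjunct1] and e2 = e[THEN conjunct2, THEN conjunct1]
    and e3 = e[THEN conjunct2, THEN conjunct2, THEN conjunct1]
    and e4 = e[THEN conjunct2, THEN conjunct2, THEN conjunct2]
  show ?thesis unfolding quotient_embedding_def
  proof (intro conjI ballI)
    fix x y assume "x \<in> tuples N' k" "y \<in> tuples N' k"
    then have V: "tuple_val N' k (\<lambda>b. if b = 0 then x else if b = 1 then y else y)" by (intro tuple_val_three)
    show "x \<in> defined_set N' k (transport h S) \<and> x @ y \<in> defined_set N' (2 * k) (transport h T) \<longrightarrow>
        y \<in> defined_set N' k (transport h S')"
      apply (rule rev_mp[OF codefinable_transfer_all[OF codefinable_imp[OF codefinable_conj[OF codefinable_mem[OF p(2), of _ _ _ 0] codefinable_pair[OF p(5), of _ _ _ 0 1]]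
            codefinable_mem[OF p(4), of _ _ _ 1]] h _ V]])
      subgoal using e1 by (auto simp: tuple_val_def)
      subgoal by simp
      done
  next
    fix x assume "x \<in> tuples N' k"
    then have V: "tuple_val N' k (\<lambda>b. if b = 0 then x else if b = 1 then x else x)" by (intro tuple_val_three)
    show "x \<in> defined_set N' k (transport h S) \<longrightarrow> (\<exists>y\<in>tuples N' k. x @ y \<in> defined_set N' (2 * k) (transport h T))"
      apply (rule rev_mp[OF codefinable_transfer_all[OF codefinable_imp[OF codefinable_mem[OF p(2), of _ _ _ 0] codefinable_ex[where b = 1, OF codefinable_pair[OF p(5), of _ _ _ 0 1]]]
            h _ V]])
      subgoal using e2 by (auto simp: tuple_val_def)
      subgoal by simp
      done
  next
    fix x y z assume "x \<in> tuples N' k" "y \<in> tuples N' k" "z \<in> tuples N' k"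
    then have V: "tuple_val N' k (\<lambda>b. if b = 0 then x else if b = 1 then y else z)" by (intro tuple_val_three)
    show "x \<in> defined_set N' k (transport h S) \<and> x @ y \<in> defined_set N' (2 * k) (transport h T) \<and>
        y @ z \<in> defined_set N' (2 * k) (transport h E') \<longrightarrow> x @ z \<in> defined_set N' (2 * k) (transport h T)"
      apply (rule rev_mp[OF codefinable_transfer_all[OF codefinable_imp[OF codefinable_conj[OF codefinable_mem[OF p(2), of _ _ _ 0]
              codefinable_conj[OF codefinable_pair[OF p(5), of _ _ _ 0 1] codefinable_pair[OF p(3), of _ _ _ 1 2]]]
            codefinable_pair[OF p(5), of _ _ _ 0 2]] h _ V]])
      subgoal using e3 by (auto simp: tuple_val_def)
      subgoal by simp
      done
  next
    fix x x' y assume "x \<in> tuples N' k" "x' \<in> tuples N' k" "y \<in> tuples N' k"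
    then have V: "tuple_val N' k (\<lambda>b. if b = 0 then x else if b = 1 then x' else y)" by (intro tuple_val_three)
    show "x \<in> defined_set N' k (transport h S) \<and> x' \<in> defined_set N' k (transport h S) \<and>
        x @ y \<in> defined_set N' (2 * k) (transport h T) \<and> x' @ y \<in> defined_set N' (2 * k) (transport h T) \<longrightarrow>
        x @ x' \<in> defined_set N' (2 * k) (transport h E)"
      apply (rule rev_mp[OF codefinable_transfer_all[OF codefinable_imp[OF codefinable_conj[OF codefinable_mem[OF p(2), of _ _ _ 0] codefinable_conj[OF codefinable_mem[OF p(2), of _ _ _ 1]
              codefinable_conj[OF codefinable_pair[OF p(5), of _ _ _ 0 2] codefinable_pair[OF p(5), of _ _ _ 1 2]]]]
            codefinable_pair[OF p(1), of _ _ _ 0 1]] h _ V]])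
      subgoal using e4 by (auto simp: tuple_val_def)
      subgoal by simp
      done
  qed
qed

lemma params_in_transport: "elementary_embedding N N' h \<Longrightarrow> params_in N P \<Longrightarrow> params_in N' (transport h P)"
  unfolding elementary_embedding_def params_in_def transport_def by auto

lemma definable_image:
  assumes "params_in N Y" "params_in N T"
  obtains Y' where "params_in N Y'"
    "defined_set N k Y' = {y \<in> tuples N k. \<exists>x\<in>tuples N k. x \<in> defined_set N k Y \<and> x @ y \<in> defined_set N (2 * k) T}"
proof -
  have "codefinable N N id k (\<lambda>V. V 1 \<in> defined_set N k Y \<and> V 1 @ V 0 \<in> defined_set N (2 * k) T)
      (\<lambda>V. V 1 \<in> defined_set N k Y \<and> V 1 @ V 0 \<in> defined_set N (2 * k) T)"
    using codefinable_conj[OF codefinable_mem[OF assms(1), of N id k 1] codefinable_pair[OF assms(2), of N id k 1 0]] by simp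
  from codefinable_ex[OF this, of 1] show ?thesis
    by (rule codefinable_pform1) (rule that, simp_all)
qed

text \<open>If the sets \<open>Y i\<close> witness that \<open>S/E\<close> has large rank, then their images under \<open>T\<close> witness the same for
  \<open>S'/E'\<close>: they are \<open>E'\<close>-invariant because \<open>T\<close> is saturated, disjoint because \<open>T\<close> separates classes, and
  by induction of rank at least that of \<open>Y i\<close>.\<close>

lemma morley_ge_embedding:
  fixes N :: "('b, 'f, 'r) fo_structure"
  assumes "morley_ge n N k E S" "quotient_embedding N k E S E' S' T"
    "params_in N E" "params_in N S" "params_in N E'" "params_in N S'" "params_in N T"
  shows "morley_ge n N k E' S'"
  using assms
proof (induction n arbitrary: N E S E' S' T)
  case 0
  then obtain x where x: "x \<in> defined_set N k S" by auto
  note e = 0(2)[unfolded quotient_embedding_def]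
  obtain y where "y \<in> tuples N k" "x @ y \<in> defined_set N (2 * k) T"
    using e x defined_set_tuples[OF x] by blast
  then have "y \<in> defined_set N k S'" using e x defined_set_tuples[OF x] by blast
  then show ?case by auto
next
  case (Suc n)
  obtain N' :: "('b, 'f, 'r) fo_structure" and h and Y :: "nat \<Rightarrow> ('b, 'f, 'r) pform"
    where h: "elementary_embedding N N' h"
    and Yp: "\<And>i. params_in N' (Y i)"
    and Ysub: "\<And>i. defined_set N' k (Y i) \<subseteq> defined_set N' k (transport h S)"
    and Yinv: "\<And>i x y. x \<in> defined_set N' k (Y i) \<Longrightarrow> y \<in> tuples N' k \<Longrightarrow>
        x @ y \<in> defined_set N' (2 * k) (transport h E) \<Longrightarrow> y \<in> defined_set N' k (Y i)"
    and Ydisj: "\<And>i j. i \<noteq> j \<Longrightarrow> defined_set N' k (Y i) \<inter> defined_set N' k (Y j) = {}"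
    and Yn: "\<And>i. morley_ge n N' k (transport h E) (Y i)"
    using Suc.prems(1)[unfolded morley_ge.simps]
    apply (elim exE conjE)
    subgoal for N' h Y by (rule that[of N' h Y]) simp_all
    done
  note emb = quotient_embedding_transfer[OF h Suc.prems(3-7,2)]
  note e = emb[unfolded quotient_embedding_def]
  note e1 = e[THEN conjunct1, rule_format] and e2 = e[THEN conjunct2, THEN conjunct1, rule_format]
    and e3 = e[THEN conjunct2, THEN conjunct2, THEN conjunct1, rule_format]
    and e4 = e[THEN conjunct2, THEN conjunct2, THEN conjunct2, rule_format]
  note par = Suc.prems(3-7)[THEN params_in_transport[OF h]]
  have "\<exists>Z. params_in N' Z \<and> defined_set N' k Z = {y \<in> tuples N' k. \<exists>x\<in>tuples N' k.
       x \<in> defined_set N' k (Y i) \<and> x @ y \<in> defined_set N' (2 * k) (transport h T)}" for i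
    by (rule definable_image[OF Yp[of i] par(5)]) (rule exI, rule conjI)
  then obtain Z where Zp: "\<And>i. params_in N' (Z i)"
    and Z: "\<And>i. defined_set N' k (Z i) = {y \<in> tuples N' k. \<exists>x\<in>tuples N' k.
       x \<in> defined_set N' k (Y i) \<and> x @ y \<in> defined_set N' (2 * k) (transport h T)}"
    by metis
  have "quotient_embedding N' k (transport h E) (Y i) (transport h E') (Z i) (transport h T)" for i
    unfolding quotient_embedding_def Z
    apply (intro conjI ballI impI)
    subgoal by blast
    subgoal using e2 Ysub by blast
    subgoal using e3 Ysub by blast
    subgoal using e4 Ysub by blast
    done
  then have "morley_ge n N' k (transport h E') (Z i)" for i
    by (rule Suc.IH[OF Yn]) (use Yp Zp par in auto)
  moreover have "defined_set N' k (Z i) \<subseteq> defined_set N' k (transport h S')" for i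
    unfolding Z using e1 Ysub by blast
  moreover have "y \<in> defined_set N' k (Z i)" if "x \<in> defined_set N' k (Z i)" "y \<in> tuples N' k"
      "x @ y \<in> defined_set N' (2 * k) (transport h E')" for i x y
    using that e3 Ysub unfolding Z by blast
  moreover have "defined_set N' k (Z i) \<inter> defined_set N' k (Z j) = {}" if "i \<noteq> j" for i j
  proof (rule ccontr)
    assume "defined_set N' k (Z i) \<inter> defined_set N' k (Z j) \<noteq> {}"
    then obtain y x x' where y: "y \<in> tuples N' k" "x \<in> tuples N' k" "x' \<in> tuples N' k"
      "x \<in> defined_set N' k (Y i)" "x @ y \<in> defined_set N' (2 * k) (transport h T)"
      "x' \<in> defined_set N' k (Y j)" "x' @ y \<in> defined_set N' (2 * k) (transport h T)"
      unfolding Z by blast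
    then have "x @ x' \<in> defined_set N' (2 * k) (transport h E)" using e4 Ysub by blast
    then have "x' \<in> defined_set N' k (Y i)" using Yinv y by blast
    then show False using y Ydisj[OF that] by blast
  qed
  ultimately show ?case unfolding morley_ge.simps using h Zp by blast
qed

text \<open>The rank of a set over \<open>M\<close> is computed in elementary extensions on the type \<open>'a + 'f + 'r + nat\<close>; this
  isomorphic copy of \<open>M\<close> is the simplest of them.\<close>

definition sum_copy :: "('a, 'f, 'r) fo_structure \<Rightarrow> ('a + 'f + 'r + nat, 'f, 'r) fo_structure" where
  "sum_copy M = \<lparr>univ = Inl ` univ M, funs = (\<lambda>f xs. Inl (funs M f (map projl xs))),
             rels = (\<lambda>R xs. rels M R (map projl xs))\<rparr>"

lemma sum_copy_simps [simp]:
  "univ (sum_copy M) = Inl ` univ M" "funs (sum_copy M) f xs = Inl (funs M f (map projl xs))"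
  "rels (sum_copy M) R xs = rels M R (map projl xs)"
  by (simp_all add: sum_copy_def)

lemma trm_val_copy: "trm_val (sum_copy M) (Inl \<circ> s) t = Inl (trm_val M s t)"
proof (induction t)
  case (App f ts)
  then have "map projl (map (trm_val (sum_copy M) (Inl \<circ> s)) ts) = map (trm_val M s) ts"
    by (auto simp: comp_def)
  then show ?case by (simp add: comp_def del: map_map map_eq_conv)
qed simp

lemma sat_copy: "sat (sum_copy M) (Inl \<circ> s) \<phi> \<longleftrightarrow> sat M s \<phi>"
proof (induction \<phi> arbitrary: s)
  case (Eq t u)
  then show ?case by (simp only: sat.simps trm_val_copy) simp
next
  case (Rel R ts)
  have "map projl (map (trm_val (sum_copy M) (Inl \<circ> s)) ts) = map (trm_val M s) ts"
    by (simp only: trm_val_copy map_map) (simp add: trm_val_copy)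
  then show ?case by (simp add: comp_def del: map_map map_eq_conv)
next
  case (Exists v \<phi>)
  have "(Inl \<circ> s)(v := Inl a) = Inl \<circ> s(v := a)" for a by auto
  then have "sat (sum_copy M) ((Inl \<circ> s)(v := Inl a)) \<phi> \<longleftrightarrow> sat M (s(v := a)) \<phi>" for a
    using Exists.IH[of "s(v := a)"] by metis
  then show ?case by (simp add: comp_def del: fun_upd_apply)
qed auto

lemma elementary_copy:
  assumes "is_structure M"
  shows "elementary_embedding M (sum_copy M) Inl"
proof -
  have "is_structure (sum_copy M)"
    unfolding is_structure_def
  proof (intro conjI allI impI)
    fix f xs assume "set xs \<subseteq> univ (sum_copy M)"
    then have "set (map projl xs) \<subseteq> univ M" by (auto simp: sum_copy_def)
    then show "funs (sum_copy M) f xs \<in> univ (sum_copy M)"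
      using assms unfolding is_structure_def by (simp add: sum_copy_def)
  qed (use assms in \<open>simp add: sum_copy_def is_structure_def\<close>)
  then show ?thesis unfolding elementary_embedding_def using assms
    by (simp add: sat_copy)
qed

lemma elementary_id: "is_structure N \<Longrightarrow> elementary_embedding N N id"
  unfolding elementary_embedding_def by simp

lemma tuples_copy: "tuples (sum_copy M) m = map Inl ` tuples M m"
proof (intro equalityI subsetI)
  fix xs assume "xs \<in> tuples (sum_copy M) m"
  then have *: "Inl (projl x) = x" "projl x \<in> univ M" if "x \<in> set xs" for x
    using that by (auto simp: tuples_def)
  then have "xs = map Inl (map projl xs)" by (simp add: map_idI)
  moreover have "map projl xs \<in> tuples M m"
    using * \<open>xs \<in> tuples (sum_copy M) m\<close> by (auto simp: tuples_def)
  ultimately show "xs \<in> map Inl ` tuples M m" by blast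
qed (auto simp: tuples_def subset_iff intro!: imageI)

lemma defined_set_copy: "defined_set (sum_copy M) m (transport Inl P) = map Inl ` defined_set M m P"
proof -
  have "sat (sum_copy M) (\<lambda>i. if i < m then map Inl xs ! i else snd (transport Inl P) i) (fst (transport Inl P)) \<longleftrightarrow>
      sat M (\<lambda>i. if i < m then xs ! i else snd P i) (fst P)" if "xs \<in> tuples M m" for xs
  proof -
    have "(\<lambda>i. if i < m then map Inl xs ! i else snd (transport Inl P) i) = Inl \<circ> (\<lambda>i. if i < m then xs ! i else snd P i)"
      using that by (auto simp: tuples_def transport_def)
    from arg_cong[OF this, of "\<lambda>s. sat (sum_copy M) s (fst P)"] show ?thesis
      unfolding sat_copy by (simp only: transport_def fst_conv)
  qed
  then show ?thesis unfolding defined_set_def tuples_copy by blast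
qed

section \<open>Definable sets in a group of finite Morley rank\<close>

locale fmr_grp = group G for G :: "'a list monoid" (structure) +
  fixes M :: "('a, 'f, 'r) fo_structure" and k :: nat
  assumes fmr: "fmr_group M k G"
begin

lemma structure_M: "is_structure M"
  using fmr by (simp add: fmr_group_def)

lemma definable_tuples: "definable M k S \<Longrightarrow> S \<subseteq> tuples M k"
  by (auto simp: definable_def dest: defined_set_tuples)

lemma definable_carrier: "definable M k (carrier G)"
  using fmr by (simp add: fmr_group_def)

lemma carrier_tuples: "x \<in> carrier G \<Longrightarrow> x \<in> tuples M k"
  using definable_tuples[OF definable_carrier] by blast

abbreviation mdef :: "((nat \<Rightarrow> 'a list) \<Rightarrow> bool) \<Rightarrow> bool" where
  "mdef p \<equiv> codefinable M M id k p p"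

lemma mdef_mem: "definable M k S \<Longrightarrow> mdef (\<lambda>V. V b \<in> S)"
  unfolding definable_def using codefinable_mem[of M _ M id k b] by auto

lemma mdef_mult: "mdef (\<lambda>V. V a \<in> carrier G \<and> V b \<in> carrier G \<and> V c = V a \<otimes> V b)"
proof -
  obtain P where P: "params_in M P"
    "defined_set M (3 * k) P = {x @ y @ (x \<otimes> y) | x y. x \<in> carrier G \<and> y \<in> carrier G}"
    using fmr unfolding fmr_group_def definable_def by blast
  have len: "length x = k" if "x \<in> carrier G" for x
    using carrier_tuples[OF that] by (simp add: tuples_def)
  have c: "codefinable M M id k (\<lambda>V. V a @ V b @ V c \<in> defined_set M (3 * k) P) (\<lambda>V. V a @ V b @ V c \<in> defined_set M (3 * k) P)"
    using codefinable_defined_set[OF P(1), of "3 * k" "[a, b, c]" k M id] by simp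
  have *: "(V a @ V b @ V c \<in> defined_set M (3 * k) P) =
      (V a \<in> carrier G \<and> V b \<in> carrier G \<and> V c = V a \<otimes> V b)" if V: "tuple_val M k V" for V
  proof -
    have "length (V i) = k" for i using V by (simp add: tuple_val_def tuples_def)
    then have "V a \<in> carrier G \<and> V b \<in> carrier G \<and> V c = V a \<otimes> V b"
      if "V a @ V b @ V c = x @ y @ x \<otimes> y" "x \<in> carrier G" "y \<in> carrier G" for x y
      using that by (simp add: len)
    then show ?thesis unfolding P(2) by blast
  qed
  show ?thesis by (rule codefinable_cong[OF c]; rule *; assumption)
qed

lemma mdef_const: "mdef p \<Longrightarrow> g \<in> carrier G \<Longrightarrow> mdef (\<lambda>V. p (V(b := g)))"
  using codefinable_const[of M M id k p p g b] by (simp add: carrier_tuples)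

lemma mdef_commute: "mdef (\<lambda>V. V a \<in> carrier G \<and> V b \<in> carrier G \<and> V a \<otimes> V b = V b \<otimes> V a)"
proof -
  define c where "c = Suc (a + b)"
  have c: "c \<noteq> a" "c \<noteq> b" by (auto simp: c_def)
  show ?thesis
    by (rule codefinable_cong[OF codefinable_ex[where b = c, OF codefinable_conj[OF mdef_mult[of a b c] mdef_mult[of b a c]]]])
       (use c carrier_tuples in \<open>auto\<close>)
qed

lemma definable_Collect:
  assumes "mdef p" "{x \<in> tuples M k. p (\<lambda>_. x)} = S"
  shows "definable M k S"
  using codefinable_pform1[OF assms(1)] assms(2) unfolding definable_def by metis

lemma definable_rel:
  assumes "mdef p"
  obtains P where "params_in M P"
    "\<And>x y. x \<in> tuples M k \<Longrightarrow> y \<in> tuples M k \<Longrightarrow> x @ y \<in> defined_set M (2 * k) P \<longleftrightarrow> p (\<lambda>b. if b = 0 then x else y)"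
    "defined_set M (2 * k) P = {x @ y | x y. x \<in> tuples M k \<and> y \<in> tuples M k \<and> p (\<lambda>b. if b = 0 then x else y)}"
proof -
  obtain P where P: "params_in M P"
    "defined_set M (2 * k) P = {x @ y | x y. x \<in> tuples M k \<and> y \<in> tuples M k \<and> p (\<lambda>b. if b = 0 then x else y)}"
    by (rule codefinable_pform2[OF assms])
  have "x @ y \<in> defined_set M (2 * k) P \<longleftrightarrow> p (\<lambda>b. if b = 0 then x else y)"
    if "x \<in> tuples M k" "y \<in> tuples M k" for x y
  proof -
    have "x' = x \<and> y' = y" if "x @ y = x' @ y'" "x' \<in> tuples M k" for x' y'
      using that \<open>x \<in> tuples M k\<close> by (auto simp: tuples_def)
    then show ?thesis unfolding P(2) using that by blast
  qed
  then show ?thesis using that P by blast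
qed

lemma definable_inter: "definable M k A \<Longrightarrow> definable M k B \<Longrightarrow> definable M k (A \<inter> B)"
  by (rule definable_Collect[OF codefinable_conj[OF mdef_mem[of A 0] mdef_mem[of B 0]]])
     (use definable_tuples in auto)

lemma definable_one: "definable M k {\<one>}"
  by (rule definable_Collect[OF mdef_mult[of 0 0 0]]) (use carrier_tuples in auto)

lemma definable_set_mult:
  assumes "definable M k A" "definable M k B" "A \<subseteq> carrier G" "B \<subseteq> carrier G"
  shows "definable M k (A <#> B)"
  by (rule definable_Collect[OF codefinable_ex[where b = 1, OF codefinable_ex[where b = 2, OF
        codefinable_conj[OF mdef_mem[OF assms(1), of 1] codefinable_conj[OF mdef_mem[OF assms(2), of 2] mdef_mult[of 1 2 0]]]]]])
     (use assms carrier_tuples in \<open>auto simp: set_mult_def subset_iff Bex_def; blast\<close>)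

lemma definable_r_coset:
  assumes "definable M k A" "A \<subseteq> carrier G" "g \<in> carrier G"
  shows "definable M k (A #> g)"
  by (rule definable_Collect[OF codefinable_ex[where b = 1, OF
        codefinable_conj[OF mdef_mem[OF assms(1), of 1] mdef_const[OF mdef_mult[of 1 2 0] assms(3), of 2]]]])
     (use assms carrier_tuples in \<open>auto simp: r_coset_def subset_iff\<close>)

definition center :: "'a list set \<Rightarrow> 'a list set" where
  "center S = {x \<in> S. \<forall>y\<in>S. x \<otimes> y = y \<otimes> x}"

lemma definable_center:
  assumes "definable M k S" "S \<subseteq> carrier G"
  shows "definable M k (center S)"
  by (rule definable_Collect[OF codefinable_conj[OF mdef_mem[OF assms(1), of 0] codefinable_all[where b = 1, OF
        codefinable_imp[OF mdef_mem[OF assms(1), of 1] mdef_commute[of 0 1]]]]])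
     (use assms carrier_tuples definable_tuples in \<open>auto simp: center_def\<close>)

lemma definable_centralizer:
  assumes "g \<in> carrier G"
  shows "definable M k {x \<in> carrier G. x \<otimes> g = g \<otimes> x}"
  by (rule definable_Collect[OF mdef_const[OF mdef_commute[of 0 1] assms, of 1]])
     (use assms carrier_tuples in auto)

text \<open>The properties of Morley rank behind the chain conditions; \<open>R n S\<close> means that \<open>S\<close>
  has rank at least \<open>n\<close>, already as computed from the copy of \<open>M\<close>. Invariance under translation and
  monotonicity are one statement, since both compare sets along a definable injection.\<close>

lemma rank_predicate:
  obtains R :: "nat \<Rightarrow> 'a list set \<Rightarrow> bool" where
    "\<And>S. definable M k S \<Longrightarrow> S \<subseteq> carrier G \<Longrightarrow> S \<noteq> {} \<Longrightarrow> R 0 S"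
    "\<And>n S Z. definable M k S \<Longrightarrow> S \<subseteq> carrier G \<Longrightarrow> (\<And>i::nat. definable M k (Z i) \<and> Z i \<subseteq> S \<and> R n (Z i)) \<Longrightarrow>
       (\<And>i j. i \<noteq> j \<Longrightarrow> Z i \<inter> Z j = {}) \<Longrightarrow> R (Suc n) S"
    "\<And>n S S' g. definable M k S \<Longrightarrow> definable M k S' \<Longrightarrow> S \<subseteq> carrier G \<Longrightarrow> S' \<subseteq> carrier G \<Longrightarrow>
       g \<in> carrier G \<Longrightarrow> S #> g \<subseteq> S' \<Longrightarrow> R n S \<Longrightarrow> R n S'"
    "\<exists>n. \<not> R n (carrier G)"
proof -
  let ?N = "sum_copy M"
  note el = elementary_copy[OF structure_M]
  have "mdef (\<lambda>V. V 0 \<in> carrier G \<and> V 1 \<in> carrier G \<and> V 0 = \<one> \<otimes> V 1)"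
    by (rule codefinable_cong[OF mdef_const[OF mdef_mult[of 2 1 0] one_closed, of 2]]) auto
  then obtain E where E: "params_in M E" and E0: "\<And>x y. x \<in> tuples M k \<Longrightarrow> y \<in> tuples M k \<Longrightarrow>
      x @ y \<in> defined_set M (2 * k) E \<longleftrightarrow> x \<in> carrier G \<and> y \<in> carrier G \<and> x = \<one> \<otimes> y"
    and E2: "defined_set M (2 * k) E = {x @ y | x y. x \<in> tuples M k \<and> y \<in> tuples M k \<and>
      x \<in> carrier G \<and> y \<in> carrier G \<and> x = \<one> \<otimes> y}"
    by (rule definable_rel) simp
  have E': "defined_set M (2 * k) E = {x @ x | x. x \<in> carrier G}"
    unfolding E2 using carrier_tuples by auto (metis l_one)
  \<comment> \<open>\<open>E\<close> defines equality on \<open>carrier G\<close>, and the same \<open>E\<close> serves for all subsets.\<close>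
  define R where "R n S \<longleftrightarrow> (\<exists>P. params_in M P \<and> defined_set M k P = S \<and>
      morley_ge n ?N k (transport Inl E) (transport Inl P))" for n S
  have Rex: "morley_ge n ?N k (transport Inl E) (transport Inl P')"
    if R: "R n S" and SS: "S \<subseteq> carrier G" "S' \<subseteq> carrier G" "g \<in> carrier G" "S #> g \<subseteq> S'"
      and P': "params_in M P'" "defined_set M k P' = S'" for n S S' g P'
  proof -
    obtain P where P: "params_in M P" "defined_set M k P = S" "morley_ge n ?N k (transport Inl E) (transport Inl P)"
      using R unfolding R_def by blast
    obtain T where T: "params_in M T" "\<And>x y. x \<in> tuples M k \<Longrightarrow> y \<in> tuples M k \<Longrightarrow>
        x @ y \<in> defined_set M (2 * k) T \<longleftrightarrow> x \<in> carrier G \<and> g \<in> carrier G \<and> y = x \<otimes> g"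
      by (rule definable_rel[OF mdef_const[OF mdef_mult[of 0 2 1] SS(3), of 2]]) simp
    have Eq: "x @ y \<in> defined_set M (2 * k) E \<longleftrightarrow> x \<in> carrier G \<and> x = y" if "x \<in> tuples M k" "y \<in> tuples M k" for x y
      using E0[OF that] by auto
    have "quotient_embedding M k E P E P' T"
      unfolding quotient_embedding_def P P'
      apply (intro conjI ballI impI)
      subgoal using SS(4) by (auto simp: T r_coset_def)
      subgoal for x using SS carrier_tuples by (auto simp: T)
      subgoal by (auto simp: T Eq)
      subgoal using SS by (auto simp: T Eq)
      done
    note quotient_embedding_transfer[OF el E P(1) E P'(1) T(1) this]
    then show ?thesis
      by (rule morley_ge_embedding[OF P(3)]) (intro params_in_transport[OF el] E P P' T)+
  qed
  show ?thesis
  proof (rule that[of R])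
    fix S assume "definable M k S" "S \<subseteq> carrier G" "S \<noteq> {}"
    then show "R 0 S" unfolding R_def definable_def by (auto simp: defined_set_copy)
  next
    fix n S and Z :: "nat \<Rightarrow> _"
    assume S: "definable M k S" "S \<subseteq> carrier G" and Z: "\<And>i. definable M k (Z i) \<and> Z i \<subseteq> S \<and> R n (Z i)"
      and disj: "\<And>i j. i \<noteq> j \<Longrightarrow> Z i \<inter> Z j = {}"
    obtain P where P: "params_in M P" "defined_set M k P = S" using S unfolding definable_def by blast
    have "\<exists>Y. params_in M Y \<and> defined_set M k Y = Z i \<and> morley_ge n ?N k (transport Inl E) (transport Inl Y)" for i
      using Z[of i] unfolding R_def by blast
    then obtain Y where Y: "\<And>i. params_in M (Y i)" "\<And>i. defined_set M k (Y i) = Z i"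
      "\<And>i. morley_ge n ?N k (transport Inl E) (transport Inl (Y i))" by metis
    have inj: "inj (map (Inl :: 'a \<Rightarrow> 'a + 'f + 'r + nat))" by simp
    have "morley_ge (Suc n) ?N k (transport Inl E) (transport Inl P)"
      unfolding morley_ge.simps
    proof (intro exI conjI allI impI)
      show "elementary_embedding ?N ?N id" using el by (intro elementary_id) (simp add: elementary_embedding_def)
      show "params_in ?N (transport Inl (Y i))" for i by (rule params_in_transport[OF el Y(1)])
      show "defined_set ?N k (transport Inl (Y i)) \<subseteq> defined_set ?N k (transport id (transport Inl P))" for i
        using Z[of i] by (auto simp: defined_set_copy Y P)
      show "y \<in> defined_set ?N k (transport Inl (Y i))"
        if "x \<in> defined_set ?N k (transport Inl (Y i)) \<and> y \<in> tuples ?N k \<and>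
          x @ y \<in> defined_set ?N (2 * k) (transport id (transport Inl E))" for i x y
      proof -
        have x: "x \<in> defined_set ?N k (transport Inl (Y i))" "y \<in> tuples ?N k"
          "x @ y \<in> map Inl ` {x @ x | x. x \<in> carrier G}"
          using that by (auto simp: defined_set_copy E')
        then obtain z where "x @ y = map Inl z @ map Inl z" by auto
        moreover have "length x = k" "length y = k" using x by (auto simp: tuples_def defined_set_def)
        ultimately have "x = y"
          by (metis append_eq_append_conv length_append length_map add_left_cancel mult_2 nat_mult_eq_cancel1 zero_less_numeral)
        then show ?thesis using x by simp
      qed
      show "defined_set ?N k (transport Inl (Y i)) \<inter> defined_set ?N k (transport Inl (Y j)) = {}" if "i \<noteq> j" for i j
        unfolding defined_set_copy Y using disj[OF that] inj by (simp flip: image_Int)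
      show "morley_ge n ?N k (transport id (transport Inl E)) (transport Inl (Y i))" for i
        using Y(3) by simp
    qed
    then show "R (Suc n) S" unfolding R_def using P by blast
  next
    fix n S S' g
    assume "definable M k S" "definable M k S'" "S \<subseteq> carrier G" "S' \<subseteq> carrier G" "g \<in> carrier G" "S #> g \<subseteq> S'" "R n S"
    moreover from this obtain P' where "params_in M P'" "defined_set M k P' = S'" unfolding definable_def by blast
    ultimately show "R n S'" using Rex[of n S S' g P'] unfolding R_def by blast
  next
    obtain n where n: "\<not> rank_ge M k (singletons (carrier G)) n"
      using fmr unfolding fmr_group_def finite_rank_def by blast
    have "rank_ge M k (singletons (carrier G)) n" if R: "R n (carrier G)"
    proof -
      obtain P where P: "params_in M P" "defined_set M k P = carrier G" "morley_ge n ?N k (transport Inl E) (transport Inl P)"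
        using R unfolding R_def by blast
      show ?thesis unfolding rank_ge_def
        apply (rule exI[of _ E], rule exI[of _ P], rule exI[of _ ?N], rule exI[of _ Inl])
        using P E el E' by (auto simp: singletons_def)
    qed
    then show "\<exists>n. \<not> R n (carrier G)" using n by blast
  qed
qed

end

section \<open>Cosets, conjugates and the normalizer condition\<close>

context group
begin

lemma r_coset_eq_iff:
  assumes "subgroup K G" "x \<in> carrier G" "y \<in> carrier G"
  shows "K #> x = K #> y \<longleftrightarrow> x \<otimes> inv y \<in> K"
proof -
  have "x \<in> K #> y \<longleftrightarrow> x \<otimes> inv y \<in> K"
    by (rule subgroup.rcos_module[OF assms(1) is_group assms(3,2)])
  moreover have "x \<in> K #> y \<longleftrightarrow> K #> x = K #> y"
    using rcos_self[OF assms(2,1)] repr_independence[OF _ assms(3,1)] by auto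
  ultimately show ?thesis by blast
qed

definition finite_index :: "'a set \<Rightarrow> 'a set \<Rightarrow> bool" where
  "finite_index K H \<longleftrightarrow> finite ((\<lambda>x. K #> x) ` H)"

lemma rcosets_carrier_update: "rcosets\<^bsub>G\<lparr>carrier := H\<rparr>\<^esub> K = (\<lambda>x. K #> x) ` H"
  by (auto simp: RCOSETS_def r_coset_def)

text \<open>\<open>L \<inter> P #> x \<mapsto> P #> x\<close> is injective on cosets, since \<open>L \<inter> P #> x = L \<inter> (P #> x)\<close> for \<open>x \<in> L\<close>.\<close>

lemma finite_index_inter:
  assumes "subgroup P G" "subgroup L G" "L \<subseteq> H" "H \<subseteq> carrier G" "finite_index P H"
  shows "finite_index (L \<inter> P) L"
proof -
  have LP: "subgroup (L \<inter> P) G" using assms by (intro subgroups_Inter_pair)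
  have "(\<lambda>x. L \<inter> P #> x) ` L \<subseteq> (\<lambda>C. L \<inter> C) ` ((\<lambda>x. P #> x) ` H)"
  proof
    fix C assume "C \<in> (\<lambda>x. L \<inter> P #> x) ` L"
    then obtain x where x: "x \<in> L" "C = L \<inter> P #> x" by blast
    then have xc: "x \<in> carrier G" using assms by blast
    have "C = L \<inter> (P #> x)"
    proof (intro equalityI subsetI)
      fix y assume "y \<in> C"
      then obtain p where "p \<in> L \<inter> P" "y = p \<otimes> x" unfolding x(2) r_coset_def by blast
      then show "y \<in> L \<inter> (P #> x)"
        using x(1) subgroup.m_closed[OF assms(2)] unfolding r_coset_def by blast
    next
      fix y assume "y \<in> L \<inter> (P #> x)"
      then obtain p where p: "p \<in> P" "y = p \<otimes> x" "y \<in> L" unfolding r_coset_def by blast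
      have pc: "p \<in> carrier G" using subgroup.mem_carrier[OF assms(1) p(1)] .
      have "p = y \<otimes> inv x" using p pc xc by (simp add: m_assoc)
      then have "p \<in> L" using p(3) x(1) assms(2) by (simp add: subgroup.m_closed subgroup.m_inv_closed)
      then show "y \<in> C" unfolding x(2) r_coset_def using p by blast
    qed
    then show "C \<in> (\<lambda>C. L \<inter> C) ` ((\<lambda>x. P #> x) ` H)" using x(1) assms(3) by blast
  qed
  moreover have "finite ((\<lambda>C. L \<inter> C) ` ((\<lambda>x. P #> x) ` H))"
    using assms(5) unfolding finite_index_def by (rule finite_imageI)
  ultimately show ?thesis unfolding finite_index_def by (rule finite_subset)
qed

lemma finite_index_trans:
  assumes "subgroup K G" "subgroup L G" "subgroup H G" "K \<subseteq> L" "L \<subseteq> H" "finite_index K L" "finite_index L H"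
  shows "finite_index K H"
proof -
  note Kc = subgroup.subset[OF assms(1)] and Lc = subgroup.subset[OF assms(2)] and Hc = subgroup.subset[OF assms(3)]
  obtain T where T: "T \<subseteq> H" "finite T" "(\<lambda>x. L #> x) ` H = (\<lambda>x. L #> x) ` T"
    using finite_subset_image[of "(\<lambda>x. L #> x) ` H" "\<lambda>x. L #> x" H] assms(7) unfolding finite_index_def by auto
  have "(\<lambda>x. K #> x) ` H \<subseteq> (\<lambda>(C, t). C #> t) ` (((\<lambda>x. K #> x) ` L) \<times> T)"
  proof
    fix C assume "C \<in> (\<lambda>x. K #> x) ` H"
    then obtain x where x: "x \<in> H" "C = K #> x" by blast
    then obtain t where t: "t \<in> T" "L #> x = L #> t" using T(3) by blast
    have tc: "t \<in> carrier G" and xc: "x \<in> carrier G" using t x T Hc by blast+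
    have l: "x \<otimes> inv t \<in> L" using r_coset_eq_iff[OF assms(2) xc tc] t by blast
    then have lc: "x \<otimes> inv t \<in> carrier G" using Lc by blast
    have "C = (K #> (x \<otimes> inv t)) #> t"
      unfolding x(2) using coset_mult_assoc[OF Kc lc tc] xc tc by (simp add: m_assoc)
    then show "C \<in> (\<lambda>(C, t). C #> t) ` (((\<lambda>x. K #> x) ` L) \<times> T)"
      using l t by auto
  qed
  then show ?thesis using assms(6) T(2) unfolding finite_index_def
    by (meson finite_SigmaI finite_imageI finite_subset)
qed

lemma finite_index_refl:
  assumes "subgroup K G" shows "finite_index K K"
proof -
  have "(\<lambda>x. K #> x) ` K \<subseteq> {K}"
    using coset_join2[OF _ assms] subgroup.mem_carrier[OF assms] by blast
  then show ?thesis unfolding finite_index_def by (rule finite_subset) simp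
qed

definition conjugate :: "'a \<Rightarrow> 'a set \<Rightarrow> 'a set" where
  "conjugate g S = (\<lambda>x. g \<otimes> x \<otimes> inv g) ` S"

lemma conjugate_mult:
  "g \<in> carrier G \<Longrightarrow> x \<in> carrier G \<Longrightarrow> y \<in> carrier G \<Longrightarrow>
   (g \<otimes> x \<otimes> inv g) \<otimes> (g \<otimes> y \<otimes> inv g) = g \<otimes> (x \<otimes> y) \<otimes> inv g"
  by (metis inv_closed inv_solve_left m_assoc m_closed)

lemma subgroup_conjugate:
  assumes "subgroup S G" "g \<in> carrier G"
  shows "subgroup (conjugate g S) G"
proof (rule subgroupI)
  have c: "x \<in> carrier G" if "x \<in> S" for x using subgroup.mem_carrier[OF assms(1) that] .
  show "conjugate g S \<subseteq> carrier G" using c assms(2) by (auto simp: conjugate_def)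
  show "conjugate g S \<noteq> {}" using subgroup.one_closed[OF assms(1)] by (auto simp: conjugate_def)
  show "inv a \<in> conjugate g S" if a: "a \<in> conjugate g S" for a
  proof -
    obtain x where x: "x \<in> S" "a = g \<otimes> x \<otimes> inv g" using a by (auto simp: conjugate_def)
    have "inv a = g \<otimes> inv x \<otimes> inv g"
      using x c assms(2) by (simp add: inv_mult_group m_assoc)
    then show ?thesis using subgroup.m_inv_closed[OF assms(1) x(1)] by (auto simp: conjugate_def)
  qed
  show "a \<otimes> b \<in> conjugate g S" if "a \<in> conjugate g S" "b \<in> conjugate g S" for a b
    using that conjugate_mult[OF assms(2)] c subgroup.m_closed[OF assms(1)] by (force simp: conjugate_def)
qed

lemma conjugate_conjugate:
  assumes "g \<in> carrier G" "h \<in> carrier G" "S \<subseteq> carrier G"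
  shows "conjugate g (conjugate h S) = conjugate (g \<otimes> h) S"
  unfolding conjugate_def image_image
  by (rule image_cong) (use assms in \<open>auto simp: inv_mult_group m_assoc subset_iff\<close>)

lemma conjugate_one: "S \<subseteq> carrier G \<Longrightarrow> conjugate \<one> S = S"
  by (simp add: conjugate_def subset_iff cong: image_cong_simp)

lemma conjugate_subset_carrier: "g \<in> carrier G \<Longrightarrow> S \<subseteq> carrier G \<Longrightarrow> conjugate g S \<subseteq> carrier G"
  by (auto simp: conjugate_def)

lemma conjugate_mono: "S \<subseteq> T \<Longrightarrow> conjugate g S \<subseteq> conjugate g T"
  by (auto simp: conjugate_def)

lemma finite_index_conjugate:
  assumes "g \<in> carrier G" "K \<subseteq> carrier G" "H \<subseteq> carrier G" "finite_index K H"
  shows "finite_index (conjugate g K) (conjugate g H)"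
proof -
  have "conjugate g K #> (g \<otimes> x \<otimes> inv g) = conjugate g (K #> x)" if "x \<in> H" for x
  proof -
    have x: "x \<in> carrier G" using that assms by blast
    have "(\<Union>y\<in>K. {g \<otimes> y \<otimes> inv g \<otimes> (g \<otimes> x \<otimes> inv g)}) = (\<Union>y\<in>K. {g \<otimes> (y \<otimes> x) \<otimes> inv g})"
      using conjugate_mult[OF assms(1) _ x] assms(2) by (intro SUP_cong) auto
    then show ?thesis unfolding r_coset_def conjugate_def by auto
  qed
  then have "(\<lambda>x. conjugate g K #> x) ` conjugate g H \<subseteq> conjugate g ` ((\<lambda>x. K #> x) ` H)"
    unfolding conjugate_def[of g H] by auto
  then show ?thesis using assms(4) unfolding finite_index_def by (meson finite_imageI finite_subset)
qed

lemma subgroup_set_mult: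
  assumes L: "subgroup L G" and A: "subgroup A G" and norm: "\<And>a l. a \<in> A \<Longrightarrow> l \<in> L \<Longrightarrow> a \<otimes> l \<otimes> inv a \<in> L"
  shows "subgroup (L <#> A) G"
proof (rule subgroupI)
  have c: "\<And>x. x \<in> L \<Longrightarrow> x \<in> carrier G" "\<And>x. x \<in> A \<Longrightarrow> x \<in> carrier G"
    using subgroup.mem_carrier[OF L] subgroup.mem_carrier[OF A] by auto
  show "L <#> A \<subseteq> carrier G" using c by (auto simp: set_mult_def)
  show "L <#> A \<noteq> {}" using subgroup.one_closed[OF L] subgroup.one_closed[OF A] by (auto simp: set_mult_def)
  show "x \<otimes> y \<in> L <#> A" if xy: "x \<in> L <#> A" "y \<in> L <#> A" for x y
  proof -
    obtain l a l' a' where *: "x = l \<otimes> a" "y = l' \<otimes> a'" "l \<in> L" "l' \<in> L" "a \<in> A" "a' \<in> A"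
      using xy by (auto simp: set_mult_def)
    have "x \<otimes> y = (l \<otimes> (a \<otimes> l' \<otimes> inv a)) \<otimes> (a \<otimes> a')"
      using * c by (simp add: m_assoc inv_solve_left)
    then show ?thesis
      using norm[OF *(5,4)] * L A by (auto simp: set_mult_def intro!: subgroup.m_closed)
  qed
  show "inv x \<in> L <#> A" if x: "x \<in> L <#> A" for x
  proof -
    obtain l a where *: "x = l \<otimes> a" "l \<in> L" "a \<in> A" using x by (auto simp: set_mult_def)
    have ia: "inv a \<in> A" using * A by (simp add: subgroup.m_inv_closed)
    have il: "inv l \<in> L" using * L by (simp add: subgroup.m_inv_closed)
    have "inv x = (inv a \<otimes> inv l \<otimes> inv (inv a)) \<otimes> inv a"
      using * c by (simp add: inv_mult_group m_assoc)
    then show ?thesis using norm[OF ia il] ia by (auto simp: set_mult_def)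
  qed
qed

lemma subset_set_mult:
  assumes "subgroup L G" "subgroup A G"
  shows "L \<subseteq> L <#> A" "A \<subseteq> L <#> A"
proof -
  have "x = x \<otimes> \<one>" if "x \<in> L" for x using subgroup.mem_carrier[OF assms(1) that] by simp
  then show "L \<subseteq> L <#> A" using subgroup.one_closed[OF assms(2)] unfolding set_mult_def by blast
  have "x = \<one> \<otimes> x" if "x \<in> A" for x using subgroup.mem_carrier[OF assms(2) that] by simp
  then show "A \<subseteq> L <#> A" using subgroup.one_closed[OF assms(1)] unfolding set_mult_def by blast
qed

lemma set_mult_subset:
  assumes "subgroup H G" "L \<subseteq> H" "A \<subseteq> H"
  shows "L <#> A \<subseteq> H"
  using assms by (auto simp: set_mult_def intro!: subgroup.m_closed)

lemma subgroup_lower_central: "subgroup (lower_central G n) G"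
proof (induction n)
  case (Suc n)
  have "{x \<otimes> y \<otimes> inv x \<otimes> inv y |x y. x \<in> lower_central G n \<and> y \<in> carrier G} \<subseteq> carrier G"
    using subgroup.mem_carrier[OF Suc] by auto
  then show ?case by (simp add: generate_is_subgroup)
qed (simp add: subgroup_self)

text \<open>Take the term of the lower central series just before the first one whose intersection with \<open>W\<close> is inside
  \<open>N\<close>, and an element \<open>x\<close> of \<open>W\<close> in this term outside \<open>N\<close>. Commutators of \<open>x\<close> with elements of \<open>N\<close> lie in \<open>W\<close> and in the next
  term, hence in \<open>N\<close>.\<close>

lemma normalizer_condition:
  assumes nil: "nilpotent G" and W: "subgroup W G" and N: "subgroup N G" "N \<subset> W"
  obtains x where "x \<in> W" "x \<notin> N" "conjugate x N = N"
proof -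
  obtain n where n: "lower_central G n = {\<one>}" using nil unfolding nilpotent_def by blast
  have ex: "\<exists>n. lower_central G n \<inter> W \<subseteq> N"
    by (rule exI[of _ n]) (use n subgroup.one_closed[OF N(1)] in auto)
  define m where "m = (LEAST n. lower_central G n \<inter> W \<subseteq> N)"
  have m: "lower_central G m \<inter> W \<subseteq> N" unfolding m_def using ex by (rule LeastI_ex)
  have "m \<noteq> 0"
  proof
    assume "m = 0"
    then have "W \<subseteq> N" using m subgroup.subset[OF W] by auto
    then show False using N by blast
  qed
  then obtain j where j: "m = Suc j" using not0_implies_Suc by blast
  then have "\<not> lower_central G j \<inter> W \<subseteq> N" using not_less_Least[of j "\<lambda>n. lower_central G n \<inter> W \<subseteq> N"] unfolding m_def by auto
  then obtain x where x: "x \<in> lower_central G j" "x \<in> W" "x \<notin> N" by blast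
  have *: "z \<otimes> y \<otimes> inv z \<in> N" if z: "z \<in> lower_central G j" "z \<in> W" and y: "y \<in> N" for z y
  proof -
    have c: "z \<in> carrier G" "y \<in> carrier G" using subgroup.mem_carrier[OF W z(2)] subgroup.mem_carrier[OF N(1) y] by auto
    have "z \<otimes> y \<otimes> inv z \<otimes> inv y \<in> lower_central G m"
      unfolding j lower_central.simps by (rule generate.incl) (use z c in blast)
    moreover have "z \<otimes> y \<otimes> inv z \<otimes> inv y \<in> W"
      using z psubsetD[OF N(2) y] W by (simp add: subgroup.m_closed subgroup.m_inv_closed)
    ultimately have "z \<otimes> y \<otimes> inv z \<otimes> inv y \<in> N" using m by blast
    then have "z \<otimes> y \<otimes> inv z \<otimes> inv y \<otimes> y \<in> N" using subgroup.m_closed[OF N(1) _ y] by simp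
    then show ?thesis using c by (simp add: m_assoc)
  qed
  have xc: "x \<in> carrier G" using subgroup.mem_carrier[OF W x(2)] .
  have ix: "inv x \<in> lower_central G j" "inv x \<in> W"
    using subgroup.m_inv_closed[OF subgroup_lower_central x(1)] subgroup.m_inv_closed[OF W x(2)] by auto
  have "conjugate x N \<subseteq> N" using *[OF x(1,2)] by (auto simp: conjugate_def)
  moreover have "N \<subseteq> conjugate x N"
  proof
    fix y assume y: "y \<in> N"
    then have yc: "y \<in> carrier G" using subgroup.mem_carrier[OF N(1)] by blast
    have "inv x \<otimes> y \<otimes> x \<in> N" using *[OF ix y] xc by simp
    moreover have "x \<otimes> (inv x \<otimes> y) = y" using xc yc by (simp flip: m_assoc)
    then have "y = x \<otimes> (inv x \<otimes> y \<otimes> x) \<otimes> inv x" using xc yc by (simp add: m_assoc)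
    ultimately show "y \<in> conjugate x N" unfolding conjugate_def by blast
  qed
  ultimately show ?thesis using that x by blast
qed

text \<open>The exponent is the order of the finite group \<open>H/K\<close>.\<close>

lemma finite_index_pow:
  assumes H: "subgroup H G" and K: "subgroup K G" "K \<subseteq> H"
    and comm: "\<And>x y. x \<in> H \<Longrightarrow> y \<in> H \<Longrightarrow> x \<otimes> y = y \<otimes> x"
    and fin: "finite_index K H"
  obtains m :: nat where "m > 0" "\<And>x. x \<in> H \<Longrightarrow> x [^] m \<in> K"
proof -
  let ?H = "G\<lparr>carrier := H\<rparr>"
  interpret H: group ?H by (rule subgroup_imp_group[OF H])
  interpret H: comm_group ?H
    by (rule H.group_comm_groupI) (use comm in simp)
  have "subgroup K ?H" using K H by (simp add: subgroup_incl)
  then interpret K: normal K ?H using H.normal_iff_subgroup by blast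
  interpret Q: group "?H Mod K" by (rule K.factorgroup_is_group)
  have carr: "carrier (?H Mod K) = (\<lambda>x. K #> x) ` H"
    by (simp add: FactGroup_def rcosets_carrier_update)
  have finQ: "finite (carrier (?H Mod K))" using fin unfolding carr finite_index_def .
  define m where "m = order (?H Mod K)"
  have "m > 0" unfolding m_def using finQ Q.order_gt_0_iff_finite by blast
  moreover have "x [^] m \<in> K" if x: "x \<in> H" for x
  proof -
    have xm: "x [^]\<^bsub>?H\<^esub> m \<in> H" using H.nat_pow_closed[of x m] x by simp
    have "(K #> x) [^]\<^bsub>?H Mod K\<^esub> m = \<one>\<^bsub>?H Mod K\<^esub>"
      unfolding m_def by (rule Q.pow_order_eq_1) (use x carr in blast)
    then have "K #>\<^bsub>?H\<^esub> (x [^]\<^bsub>?H\<^esub> m) = K"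
      using K.FactGroup_pow[of x m] x by (simp add: r_coset_def)
    then have "x [^]\<^bsub>?H\<^esub> m \<in> K"
      using H.rcos_self[of "x [^]\<^bsub>?H\<^esub> m" K] xm \<open>subgroup K ?H\<close> by simp
    then show ?thesis by (simp flip: nat_pow_consistent)
  qed
  ultimately show ?thesis using that by blast
qed

lemma torsion_free_quotient_iff:
  assumes A: "subgroup A G" and J: "subgroup J G" "J \<subseteq> A"
    and comm: "\<And>x y. x \<in> A \<Longrightarrow> y \<in> A \<Longrightarrow> x \<otimes> y = y \<otimes> x"
  shows "torsion_free (G\<lparr>carrier := A\<rparr> Mod J) \<longleftrightarrow> (\<forall>a\<in>A. \<forall>n::nat. n > 0 \<and> a [^] n \<in> J \<longrightarrow> a \<in> J)"
proof -
  let ?H = "G\<lparr>carrier := A\<rparr>"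
  interpret H: group ?H by (rule subgroup_imp_group[OF A])
  interpret H: comm_group ?H
    by (rule H.group_comm_groupI) (use comm in simp)
  have JH: "subgroup J ?H" using J A by (simp add: subgroup_incl)
  then interpret K: normal J ?H using H.normal_iff_subgroup by blast
  have carr: "carrier (?H Mod J) = (\<lambda>x. J #> x) ` A"
    by (simp add: FactGroup_def rcosets_carrier_update)
  have rc: "J #>\<^bsub>?H\<^esub> x = J #> x" for x by (simp add: r_coset_def)
  have Ac: "x \<in> carrier G" if "x \<in> A" for x using subgroup.mem_carrier[OF A that] .
  have mem: "J #> x = J \<longleftrightarrow> x \<in> J" if "x \<in> A" for x
    using that Ac J by (metis coset_join2 rcos_self)
  have pw: "(J #> x) [^]\<^bsub>?H Mod J\<^esub> n = J #> (x [^] n)" "x [^] n \<in> A" if "x \<in> A" for x and n :: nat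
    using K.FactGroup_pow[of x n] H.nat_pow_closed[of x n] that
    by (simp_all add: r_coset_def flip: nat_pow_consistent)
  show ?thesis unfolding torsion_free_def carr ball_simps
    by (simp add: pw mem)
qed

end

section \<open>Chain conditions and connected subgroups\<close>

context fmr_grp
begin

abbreviation dsub :: "'a list set \<Rightarrow> bool" where
  "dsub H \<equiv> definable_subgroup M k G H"

abbreviation conn :: "'a list set \<Rightarrow> bool" where
  "conn H \<equiv> connected_subgroup M k G H"

lemma dsubD:
  assumes "dsub H"
  shows "subgroup H G" "definable M k H" "H \<subseteq> carrier G"
  using assms subgroup.subset[of H G] by (auto simp: definable_subgroup_def)

lemma dsub_inter: "dsub A \<Longrightarrow> dsub B \<Longrightarrow> dsub (A \<inter> B)"
  by (simp add: definable_subgroup_def definable_inter subgroups_Inter_pair)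

lemma dsub_one: "dsub {\<one>}"
  by (simp add: definable_subgroup_def definable_one triv_subgroup)

lemma dsub_mult:
  assumes "dsub L" "dsub A" "\<And>a l. a \<in> A \<Longrightarrow> l \<in> L \<Longrightarrow> a \<otimes> l \<otimes> inv a \<in> L"
  shows "dsub (L <#> A)"
  using subgroup_set_mult[OF dsubD(1)[OF assms(1)] dsubD(1)[OF assms(2)] assms(3)]
    definable_set_mult[OF dsubD(2)[OF assms(1)] dsubD(2)[OF assms(2)] dsubD(3)[OF assms(1)] dsubD(3)[OF assms(2)]]
  by (simp add: definable_subgroup_def)

lemma definable_conjugate:
  assumes "definable M k S" "S \<subseteq> carrier G" "g \<in> carrier G"
  shows "definable M k (conjugate g S)"
proof -
  have ig: "inv g \<in> carrier G" using assms by simp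
  have "definable M k ((\<lambda>x. g \<otimes> x) ` S)"
    by (rule definable_Collect[OF codefinable_ex[where b = 1, OF
        codefinable_conj[OF mdef_mem[OF assms(1), of 1] mdef_const[OF mdef_mult[of 2 1 0] assms(3), of 2]]]])
     (use assms carrier_tuples in \<open>auto simp: subset_iff\<close>)
  moreover have "conjugate g S = ((\<lambda>x. g \<otimes> x) ` S) #> inv g"
    by (auto simp: conjugate_def r_coset_def)
  ultimately show ?thesis using definable_r_coset[OF _ _ ig] assms by (auto simp: image_subset_iff subset_iff)
qed

lemma dsub_conjugate: "dsub S \<Longrightarrow> g \<in> carrier G \<Longrightarrow> dsub (conjugate g S)"
  unfolding definable_subgroup_def
  by (intro conjI subgroup_conjugate definable_conjugate) (auto dest: subgroup.subset)

lemma conn_iff: "conn H \<longleftrightarrow> dsub H \<and> (\<forall>K. dsub K \<longrightarrow> K \<subset> H \<longrightarrow> \<not> finite_index K H)"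
  unfolding connected_subgroup_def rcosets_carrier_update finite_index_def by blast

lemma connI: "dsub H \<Longrightarrow> (\<And>K. dsub K \<Longrightarrow> K \<subseteq> H \<Longrightarrow> finite_index K H \<Longrightarrow> H \<subseteq> K) \<Longrightarrow> conn H"
  unfolding conn_iff by blast

lemma connD: "conn H \<Longrightarrow> dsub H" "conn H \<Longrightarrow> dsub K \<Longrightarrow> K \<subseteq> H \<Longrightarrow> finite_index K H \<Longrightarrow> K = H"
  unfolding conn_iff by blast+

lemma r_coset_disjoint:
  assumes "subgroup K G" "x \<in> carrier G" "y \<in> carrier G" "K #> x \<noteq> K #> y"
  shows "(K #> x) \<inter> (K #> y) = {}"
proof (rule ccontr)
  assume "(K #> x) \<inter> (K #> y) \<noteq> {}"
  then obtain z where "z \<in> K #> x" "z \<in> K #> y" by blast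
  then have "K #> x = K #> z" "K #> y = K #> z"
    using repr_independence[OF _ assms(2,1)] repr_independence[OF _ assms(3,1)] by blast+
  then show False using assms(4) by simp
qed

text \<open>Each \<open>H i\<close> contains infinitely many disjoint translates of later members of the chain: one coset of
  \<open>H (Suc j)\<close> in the complement of \<open>H (Suc j)\<close> in \<open>H j\<close> for every \<open>j \<ge> i\<close>. So if all members have rank
  at least \<open>n\<close>, they all have rank at least \<open>n + 1\<close>, and the rank would be infinite.\<close>

lemma no_descending_chain:
  assumes H: "\<And>i :: nat. dsub (H i)" and desc: "\<And>i. H (Suc i) \<subset> H i"
  shows False
proof -
  obtain R :: "nat \<Rightarrow> 'a list set \<Rightarrow> bool" where
    R0: "\<And>S. definable M k S \<Longrightarrow> S \<subseteq> carrier G \<Longrightarrow> S \<noteq> {} \<Longrightarrow> R 0 S" and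
    RS: "\<And>n S Z. definable M k S \<Longrightarrow> S \<subseteq> carrier G \<Longrightarrow> (\<And>i::nat. definable M k (Z i) \<and> Z i \<subseteq> S \<and> R n (Z i)) \<Longrightarrow>
       (\<And>i j. i \<noteq> j \<Longrightarrow> Z i \<inter> Z j = {}) \<Longrightarrow> R (Suc n) S" and
    RT: "\<And>n S S' g. definable M k S \<Longrightarrow> definable M k S' \<Longrightarrow> S \<subseteq> carrier G \<Longrightarrow> S' \<subseteq> carrier G \<Longrightarrow>
       g \<in> carrier G \<Longrightarrow> S #> g \<subseteq> S' \<Longrightarrow> R n S \<Longrightarrow> R n S'" and
    Rfin: "\<exists>n. \<not> R n (carrier G)"
    by (rule rank_predicate) blast
  note Hd = dsubD[OF H]
  have "\<exists>g. g \<in> H i \<and> g \<notin> H (Suc i)" for i using desc[of i] by blast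
  then obtain g where g: "\<And>i. g i \<in> H i" "\<And>i. g i \<notin> H (Suc i)" by metis
  have gc: "g i \<in> carrier G" for i using g(1) Hd(3) by blast
  have mono: "H j \<subseteq> H i" if "i \<le> j" for i j using lift_Suc_antimono_le[of H] desc that by blast
  have R: "R n (H i)" for n i
  proof (induction n arbitrary: i)
    case 0
    show ?case by (rule R0[OF Hd(2,3)]) (use g in blast)
  next
    case (Suc n)
    define Z where "Z j = H (Suc (i + j)) #> g (i + j)" for j
    have Zsub: "Z j \<subseteq> H (i + j)" for j
      unfolding Z_def r_coset_def using desc[of "i + j"] g(1)[of "i + j"] subgroup.m_closed[OF Hd(1)[of "i + j"]] by blast
    have Zc: "Z j \<subseteq> carrier G" for j using Zsub Hd(3) by blast
    have Zd: "definable M k (Z j)" for j unfolding Z_def by (rule definable_r_coset[OF Hd(2,3) gc])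
    have out: "Z j \<inter> H (Suc (i + j)) = {}" for j
    proof -
      have "H (Suc (i + j)) #> g (i + j) \<noteq> H (Suc (i + j)) #> \<one>"
        using r_coset_eq_iff[OF Hd(1) gc one_closed] g(2) gc by simp
      then have "(H (Suc (i + j)) #> g (i + j)) \<inter> (H (Suc (i + j)) #> \<one>) = {}"
        by (rule r_coset_disjoint[OF Hd(1) gc one_closed])
      then show ?thesis unfolding Z_def using Hd(3) by simp
    qed
    have disj: "Z j \<inter> Z j' = {}" if "j < j'" for j j'
      using out[of j] Zsub[of j'] mono[of "Suc (i + j)" "i + j'"] that by auto
    show ?case
    proof (rule RS[OF Hd(2,3)])
      have "R n (Z j)" for j
        by (rule RT[OF Hd(2) Zd Hd(3) Zc gc[of "i + j"] _ Suc[of "Suc (i + j)"]]) (simp add: Z_def)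
      then show "definable M k (Z j) \<and> Z j \<subseteq> H i \<and> R n (Z j)" for j
        using Zd Zsub[of j] mono[of i "i + j"] by auto
      show "Z j \<inter> Z j' = {}" if "j \<noteq> j'" for j j'
        using disj[of j j'] disj[of j' j] that by (cases "j < j'") auto
    qed
  qed
  have "R n (carrier G)" for n
    by (rule RT[OF Hd(2) definable_carrier Hd(3) _ one_closed _ R[of n 0]]) (use Hd(3) in auto)
  then show False using Rfin by blast
qed

text \<open>A proper definable subgroup of a connected group has infinite index, so the rank grows at every step of
  the chain.\<close>

lemma no_ascending_chain:
  assumes H: "\<And>i :: nat. conn (H i)" and asc: "\<And>i. H i \<subset> H (Suc i)"
  shows False
proof -
  obtain R :: "nat \<Rightarrow> 'a list set \<Rightarrow> bool" where
    R0: "\<And>S. definable M k S \<Longrightarrow> S \<subseteq> carrier G \<Longrightarrow> S \<noteq> {} \<Longrightarrow> R 0 S" and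
    RS: "\<And>n S Z. definable M k S \<Longrightarrow> S \<subseteq> carrier G \<Longrightarrow> (\<And>i::nat. definable M k (Z i) \<and> Z i \<subseteq> S \<and> R n (Z i)) \<Longrightarrow>
       (\<And>i j. i \<noteq> j \<Longrightarrow> Z i \<inter> Z j = {}) \<Longrightarrow> R (Suc n) S" and
    RT: "\<And>n S S' g. definable M k S \<Longrightarrow> definable M k S' \<Longrightarrow> S \<subseteq> carrier G \<Longrightarrow> S' \<subseteq> carrier G \<Longrightarrow>
       g \<in> carrier G \<Longrightarrow> S #> g \<subseteq> S' \<Longrightarrow> R n S \<Longrightarrow> R n S'" and
    Rfin: "\<exists>n. \<not> R n (carrier G)"
    by (rule rank_predicate) blast
  note Hd = dsubD[OF connD(1)[OF H]]
  have R: "R n (H n)" for n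
  proof (induction n)
    case 0
    show ?case by (rule R0[OF Hd(2,3)]) (use subgroup.one_closed[OF Hd(1)] in blast)
  next
    case (Suc n)
    have "\<not> finite_index (H n) (H (Suc n))"
      using H[of "Suc n"] asc[of n] connD(1)[OF H[of n]] unfolding conn_iff by blast
    then have inf: "infinite ((\<lambda>x. H n #> x) ` H (Suc n))" unfolding finite_index_def .
    obtain Z :: "nat \<Rightarrow> _" where Z: "inj Z" "range Z \<subseteq> (\<lambda>x. H n #> x) ` H (Suc n)"
      using infinite_countable_subset[OF inf] by blast
    then have "\<exists>g. g \<in> H (Suc n) \<and> Z j = H n #> g" for j by blast
    then obtain g where g: "\<And>j. g j \<in> H (Suc n)" "\<And>j. Z j = H n #> g j" by metis
    have gc: "g j \<in> carrier G" for j using g(1) Hd(3) by blast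
    have Zsub: "Z j \<subseteq> H (Suc n)" for j
      unfolding g(2) r_coset_def using asc[of n] g(1) subgroup.m_closed[OF Hd(1)[of "Suc n"]] by blast
    have Zd: "definable M k (Z j)" for j unfolding g(2) by (rule definable_r_coset[OF Hd(2,3) gc])
    show ?case
    proof (rule RS[OF Hd(2,3)])
      have "R n (Z j)" for j
        by (rule RT[OF Hd(2) Zd Hd(3) _ gc _ Suc]) (use Zsub Hd(3) g(2) in blast)+
      then show "definable M k (Z j) \<and> Z j \<subseteq> H (Suc n) \<and> R n (Z j)" for j
        using Zd Zsub by blast
      show "Z j \<inter> Z j' = {}" if "j \<noteq> j'" for j j'
      proof -
        have "Z j \<noteq> Z j'" using Z(1) that by (meson injD)
        then show ?thesis unfolding g(2) by (rule r_coset_disjoint[OF Hd(1) gc gc])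
      qed
    qed
  qed
  have "R n (carrier G)" for n
    by (rule RT[OF Hd(2) definable_carrier Hd(3) _ one_closed _ R[of n]]) (use Hd(3) in auto)
  then show False using Rfin by blast
qed

lemma minimal_dsub:
  assumes "\<And>H. H \<in> S \<Longrightarrow> dsub H" "S \<noteq> {}"
  obtains H where "H \<in> S" "\<And>K. K \<in> S \<Longrightarrow> \<not> K \<subset> H"
proof -
  have "wf {(K, H). dsub K \<and> dsub H \<and> K \<subset> H}"
    unfolding wf_iff_no_infinite_down_chain using no_descending_chain by blast
  then obtain H where H: "H \<in> S" "\<And>K. (K, H) \<in> {(K, H). dsub K \<and> dsub H \<and> K \<subset> H} \<Longrightarrow> K \<notin> S"
    by (rule wfE_min'[OF _ assms(2)]) blast
  show ?thesis
  proof (rule that[OF H(1)])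
    show "\<not> K \<subset> H" if "K \<in> S" for K
      using H(2)[of K] assms(1)[OF H(1)] assms(1)[OF that] that by auto
  qed
qed

lemma maximal_conn:
  assumes "\<And>H. H \<in> S \<Longrightarrow> conn H" "S \<noteq> {}"
  obtains H where "H \<in> S" "\<And>K. K \<in> S \<Longrightarrow> \<not> H \<subset> K"
proof -
  have "wf {(K, H). conn K \<and> conn H \<and> H \<subset> K}"
    unfolding wf_iff_no_infinite_down_chain using no_ascending_chain by blast
  then obtain H where H: "H \<in> S" "\<And>K. (K, H) \<in> {(K, H). conn K \<and> conn H \<and> H \<subset> K} \<Longrightarrow> K \<notin> S"
    by (rule wfE_min'[OF _ assms(2)]) blast
  show ?thesis
  proof (rule that[OF H(1)])
    show "\<not> H \<subset> K" if "K \<in> S" for K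
      using H(2)[of K] assms(1)[OF H(1)] assms(1)[OF that] that by auto
  qed
qed

lemma conn_one: "conn {\<one>}"
proof (rule connI[OF dsub_one])
  fix K assume "dsub K"
  then show "{\<one>} \<subseteq> K" using subgroup.one_closed[OF dsubD(1)] by blast
qed

text \<open>A definable subgroup of finite index in \<open>L A\<close> meets both factors in finite index, hence contains them.\<close>

lemma conn_mult:
  assumes L: "conn L" and A: "conn A" and norm: "\<And>a l. a \<in> A \<Longrightarrow> l \<in> L \<Longrightarrow> a \<otimes> l \<otimes> inv a \<in> L"
  shows "conn (L <#> A)"
proof -
  note Ld = connD(1)[OF L] and Ad = connD(1)[OF A]
  have d: "dsub (L <#> A)" by (rule dsub_mult[OF Ld Ad norm])
  show ?thesis
  proof (rule connI[OF d])
    fix P assume P: "dsub P" "P \<subseteq> L <#> A" "finite_index P (L <#> A)"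
    note sub = subset_set_mult[OF dsubD(1)[OF Ld] dsubD(1)[OF Ad]]
    have "L \<inter> P = L"
      by (rule connD(2)[OF L dsub_inter[OF Ld P(1)]])
         (use finite_index_inter[OF dsubD(1)[OF P(1)] dsubD(1)[OF Ld] sub(1) dsubD(3)[OF d] P(3)] in auto)
    moreover have "A \<inter> P = A"
      by (rule connD(2)[OF A dsub_inter[OF Ad P(1)]])
         (use finite_index_inter[OF dsubD(1)[OF P(1)] dsubD(1)[OF Ad] sub(2) dsubD(3)[OF d] P(3)] in auto)
    ultimately show "L <#> A \<subseteq> P" using set_mult_subset[OF dsubD(1)[OF P(1)]] by blast
  qed
qed

lemma conn_conjugate:
  assumes L: "conn L" and g: "g \<in> carrier G"
  shows "conn (conjugate g L)"
proof -
  note Ld = connD(1)[OF L]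
  have ig: "inv g \<in> carrier G" using g by simp
  have cancel: "conjugate (inv g) (conjugate g S) = S" "conjugate g (conjugate (inv g) S) = S" if "S \<subseteq> carrier G" for S
    using that g by (simp_all add: conjugate_conjugate conjugate_one)
  show ?thesis
  proof (rule connI[OF dsub_conjugate[OF Ld g]])
    fix K assume K: "dsub K" "K \<subseteq> conjugate g L" "finite_index K (conjugate g L)"
    have "conjugate (inv g) K = L"
    proof (rule connD(2)[OF L dsub_conjugate[OF K(1) ig]])
      show "conjugate (inv g) K \<subseteq> L" using conjugate_mono[OF K(2), of "inv g"] cancel(1)[OF dsubD(3)[OF Ld]] by simp
      show "finite_index (conjugate (inv g) K) L"
        using finite_index_conjugate[OF ig dsubD(3)[OF K(1)] conjugate_subset_carrier[OF g dsubD(3)[OF Ld]] K(3)]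
          cancel(1)[OF dsubD(3)[OF Ld]] by simp
    qed
    then show "conjugate g L \<subseteq> K" using cancel(2)[OF dsubD(3)[OF K(1)]] by simp
  qed
qed

text \<open>A minimal definable subgroup of finite index is connected, since finite index is transitive.\<close>

lemma connected_component:
  assumes B: "dsub B"
  obtains C where "conn C" "C \<subseteq> B" "finite_index C B"
proof -
  obtain C where C: "C \<in> {C. dsub C \<and> C \<subseteq> B \<and> finite_index C B}"
    "\<And>K. K \<in> {C. dsub C \<and> C \<subseteq> B \<and> finite_index C B} \<Longrightarrow> \<not> K \<subset> C"
  proof (rule minimal_dsub[of "{C. dsub C \<and> C \<subseteq> B \<and> finite_index C B}"])
    show "{C. dsub C \<and> C \<subseteq> B \<and> finite_index C B} \<noteq> {}"
      using B finite_index_refl[OF dsubD(1)[OF B]] by blast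
  qed auto
  then have C': "dsub C" "C \<subseteq> B" "finite_index C B" by auto
  have "conn C"
  proof (rule connI[OF C'(1)])
    fix K assume K: "dsub K" "K \<subseteq> C" "finite_index K C"
    have "finite_index K B"
      by (rule finite_index_trans[OF dsubD(1)[OF K(1)] dsubD(1)[OF C'(1)] dsubD(1)[OF B] K(2) C'(2) K(3) C'(3)])
    then have "\<not> K \<subset> C" using C(2)[of K] K C' by blast
    then show "C \<subseteq> K" using K(2) by blast
  qed
  then show ?thesis using that C' by blast
qed

text \<open>Let \<open>L\<close> be maximal among the proper connected definable subgroups of \<open>W\<close> above \<open>L0\<close>. A connected
  definable \<open>A \<le> W\<close> that normalizes \<open>L\<close> makes \<open>L A\<close> connected, so \<open>A \<le> L\<close> or \<open>L A = W\<close>. Let \<open>N\<close> be the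
  normalizer of \<open>L\<close> in \<open>W\<close>. If \<open>N\<close> were proper, some \<open>x \<notin> N\<close> would normalize \<open>N\<close>; the conjugate of \<open>L\<close> by \<open>x\<close>
  would be inside \<open>N\<close>, hence normalize \<open>L\<close>, hence be contained in \<open>L\<close>, so that \<open>x \<in> N\<close>. Therefore
  \<open>L\<close> is normal in \<open>W\<close>, and as the members of \<open>FF\<close> generate \<open>W\<close> one of them is not inside \<open>L\<close>. In
  particular \<open>W = L A\<close> is definable and connected.\<close>

lemma proper_connected_cosubgroup:
  assumes nil: "nilpotent G" and FF: "\<And>A. A \<in> FF \<Longrightarrow> conn A" and W: "W = generate G (\<Union>FF)"
    and L0: "conn L0" "L0 \<subset> W"
  obtains L A where "conn L" "L0 \<subseteq> L" "L \<subset> W" "\<And>x. x \<in> W \<Longrightarrow> conjugate x L = L" "A \<in> FF" "L <#> A = W"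
proof -
  have sub: "\<Union>FF \<subseteq> carrier G" using FF connD(1) dsubD(3) by blast
  have Ws: "subgroup W G" unfolding W by (rule generate_is_subgroup[OF sub])
  note Wc = subgroup.subset[OF Ws]
  have FW: "A \<subseteq> W" if "A \<in> FF" for A unfolding W using that generate.incl[of _ "\<Union>FF" G] by blast
  obtain L where L: "L \<in> {L. conn L \<and> L0 \<subseteq> L \<and> L \<subset> W}"
    "\<And>K. K \<in> {L. conn L \<and> L0 \<subseteq> L \<and> L \<subset> W} \<Longrightarrow> \<not> L \<subset> K"
  proof (rule maximal_conn[of "{L. conn L \<and> L0 \<subseteq> L \<and> L \<subset> W}"])
    show "{L. conn L \<and> L0 \<subseteq> L \<and> L \<subset> W} \<noteq> {}" using L0 by blast
  qed auto
  then have L': "conn L" "L0 \<subseteq> L" "L \<subset> W" by auto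
  note Ld = dsubD[OF connD(1)[OF L'(1)]]
  have max: "A \<subseteq> L \<or> L <#> A = W" if A: "conn A" "A \<subseteq> W" "\<And>a l. a \<in> A \<Longrightarrow> l \<in> L \<Longrightarrow> a \<otimes> l \<otimes> inv a \<in> L" for A
  proof -
    note s = subset_set_mult[OF Ld(1) dsubD(1)[OF connD(1)[OF A(1)]]]
    have c: "conn (L <#> A)" by (rule conn_mult[OF L'(1) A(1,3)])
    have "L <#> A \<subseteq> W" by (rule set_mult_subset[OF Ws]) (use L' A in auto)
    then have "L <#> A = W \<or> \<not> L \<subset> L <#> A" using L(2)[of "L <#> A"] c L'(2) s by blast
    then show ?thesis using s by blast
  qed
  define N where "N = {x \<in> W. conjugate x L = L}"
  have Nc: "x \<in> carrier G" if "x \<in> N" for x using that Wc unfolding N_def by blast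
  have Ns: "subgroup N G"
  proof (rule subgroupI)
    show "N \<subseteq> carrier G" using Nc by blast
    show "N \<noteq> {}" using conjugate_one[OF Ld(3)] subgroup.one_closed[OF Ws] unfolding N_def by blast
    show "inv x \<in> N" if "x \<in> N" for x
    proof -
      have "conjugate (inv x) (conjugate x L) = L"
        using conjugate_conjugate[of "inv x" x L] Nc[OF that] Ld(3) by (simp add: conjugate_one)
      then show ?thesis using that subgroup.m_inv_closed[OF Ws] unfolding N_def by simp
    qed
    show "x \<otimes> y \<in> N" if "x \<in> N" "y \<in> N" for x y
      using that conjugate_conjugate[OF Nc[OF that(1)] Nc[OF that(2)] Ld(3)] subgroup.m_closed[OF Ws]
      unfolding N_def by simp
  qed
  have LN: "L \<subseteq> N"
  proof
    fix x assume x: "x \<in> L"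
    have xc: "x \<in> carrier G" using x Ld(3) by blast
    have s: "conjugate y L \<subseteq> L" if "y \<in> L" for y
      using that Ld(1) by (auto simp: conjugate_def subgroup.m_closed subgroup.m_inv_closed)
    have "conjugate x (conjugate (inv x) L) \<subseteq> conjugate x L"
      by (rule conjugate_mono[OF s]) (rule subgroup.m_inv_closed[OF Ld(1) x])
    then have "L \<subseteq> conjugate x L" using xc Ld(3) by (simp add: conjugate_conjugate conjugate_one)
    then show "x \<in> N" using s[OF x] x L'(3) unfolding N_def by blast
  qed
  have "N = W"
  proof (rule ccontr)
    assume "N \<noteq> W"
    then have NW: "N \<subset> W" unfolding N_def by blast
    obtain x where x: "x \<in> W" "x \<notin> N" "conjugate x N = N"
      by (rule normalizer_condition[OF nil Ws Ns NW])
    have xc: "x \<in> carrier G" using x Wc by blast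
    have ixN: "conjugate (inv x) N = N"
      using conjugate_conjugate[of "inv x" x N] x(3) xc subgroup.subset[OF Ns] by (simp add: conjugate_one)
    have s: "conjugate y L \<subseteq> L" if y: "y \<in> carrier G" "conjugate y N = N" for y
    proof -
      have yN: "conjugate y L \<subseteq> N" using conjugate_mono[OF LN, of y] y(2) by simp
      have "conjugate y L \<subseteq> L \<or> L <#> conjugate y L = W"
      proof (rule max[OF conn_conjugate[OF L'(1) y(1)]])
        show "conjugate y L \<subseteq> W" using yN NW by blast
        show "a \<otimes> l \<otimes> inv a \<in> L" if "a \<in> conjugate y L" "l \<in> L" for a l
          using that yN unfolding N_def conjugate_def by blast
      qed
      moreover have "L <#> conjugate y L \<subseteq> N" by (rule set_mult_subset[OF Ns LN yN])
      ultimately show ?thesis using NW by blast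
    qed
    have "conjugate x (conjugate (inv x) L) \<subseteq> conjugate x L"
      by (rule conjugate_mono[OF s]) (use xc ixN in auto)
    then have "L \<subseteq> conjugate x L" using xc Ld(3) by (simp add: conjugate_conjugate conjugate_one)
    then have "x \<in> N" using s[OF xc x(3)] x(1) unfolding N_def by blast
    then show False using x(2) by blast
  qed
  have "\<exists>A\<in>FF. L <#> A = W"
  proof (rule ccontr)
    assume no: "\<not> (\<exists>A\<in>FF. L <#> A = W)"
    have "A \<subseteq> L" if A: "A \<in> FF" for A
    proof -
      have "A \<subseteq> L \<or> L <#> A = W"
      proof (rule max[OF FF[OF A] FW[OF A]])
        show "a \<otimes> l \<otimes> inv a \<in> L" if "a \<in> A" "l \<in> L" for a l
          using that FW[OF A] \<open>N = W\<close> unfolding N_def conjugate_def by blast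
      qed
      then show ?thesis using no A by blast
    qed
    then have "W \<subseteq> L" unfolding W by (intro generate_subgroup_incl[OF _ Ld(1)]) blast
    then show False using L'(3) by blast
  qed
  then show ?thesis using that L' \<open>N = W\<close> unfolding N_def by blast
qed

text \<open>A special case of Zilber's theorem on subgroups generated by connected subgroups; nilpotency replaces
  the usual argument with generic types.\<close>

lemma generated_by_connected:
  assumes nil: "nilpotent G" and FF: "\<And>A. A \<in> FF \<Longrightarrow> conn A"
  shows "conn (generate G (\<Union>FF))"
proof (cases "generate G (\<Union>FF) = {\<one>}")
  case True
  then show ?thesis by (simp add: conn_one)
next
  case False
  let ?W = "generate G (\<Union>FF)"
  have "{\<one>} \<subset> ?W" using False generate.one[of G "\<Union>FF"] by blast
  then obtain L A where L: "conn L" "L \<subset> ?W" "\<And>x. x \<in> ?W \<Longrightarrow> conjugate x L = L" "A \<in> FF" "L <#> A = ?W"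
    using proper_connected_cosubgroup[OF nil FF refl conn_one] by metis
  have "A \<subseteq> ?W" using L(4) generate.incl[of _ "\<Union>FF" G] by blast
  then have "a \<otimes> l \<otimes> inv a \<in> L" if "a \<in> A" "l \<in> L" for a l
    using that L(3) unfolding conjugate_def by blast
  then have "conn (L <#> A)" by (rule conn_mult[OF L(1) FF[OF L(4)]])
  then show ?thesis using L(5) by simp
qed

end

section \<open>The radical of an abelian subgroup\<close>

context fmr_grp
begin

lemma definable_pow_graph: "mdef (\<lambda>V. V a \<in> carrier G \<and> V b = V a [^] (m::nat))"
proof (induction m arbitrary: b)
  case 0
  have "mdef (\<lambda>V. V a \<in> carrier G \<and> V b \<in> {\<one>})"
    by (rule codefinable_conj[OF mdef_mem[OF definable_carrier] mdef_mem[OF definable_one]])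
  then show ?case by (rule codefinable_cong) auto
next
  case (Suc m)
  define c where "c = Suc (a + b)"
  have c: "c \<noteq> a" "c \<noteq> b" by (auto simp: c_def)
  show ?case
    by (rule codefinable_cong[OF codefinable_ex[where b = c, OF codefinable_conj[OF Suc[of c] mdef_mult[of c a b]]]])
       (use c carrier_tuples in \<open>auto\<close>)
qed

lemma dsub_pow_image:
  assumes A: "dsub A" and comm: "\<And>x y. x \<in> A \<Longrightarrow> y \<in> A \<Longrightarrow> x \<otimes> y = y \<otimes> x"
  shows "dsub ((\<lambda>x. x [^] (m::nat)) ` A)"
proof -
  note Ad = dsubD[OF A]
  have c: "x \<in> carrier G" if "x \<in> A" for x using Ad(3) that by blast
  have "definable M k ((\<lambda>x. x [^] m) ` A)"
    by (rule definable_Collect[OF codefinable_ex[where b = 1, OF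
          codefinable_conj[OF mdef_mem[OF Ad(2), of 1] definable_pow_graph[of 1 0 m]]]])
       (use c carrier_tuples in \<open>auto\<close>)
  moreover have "subgroup ((\<lambda>x. x [^] m) ` A) G"
  proof (rule subgroupI)
    show "(\<lambda>x. x [^] m) ` A \<subseteq> carrier G" using c by auto
    show "(\<lambda>x. x [^] m) ` A \<noteq> {}" using subgroup.one_closed[OF Ad(1)] by blast
    show "inv a \<in> (\<lambda>x. x [^] m) ` A" if a: "a \<in> (\<lambda>x. x [^] m) ` A" for a
    proof -
      obtain x where x: "x \<in> A" "a = x [^] m" using a by blast
      have "inv a = inv x [^] m" using x c by (simp add: nat_pow_inv)
      then show ?thesis using subgroup.m_inv_closed[OF Ad(1) x(1)] by blast
    qed
    show "a \<otimes> b \<in> (\<lambda>x. x [^] m) ` A" if ab: "a \<in> (\<lambda>x. x [^] m) ` A" "b \<in> (\<lambda>x. x [^] m) ` A" for a b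
    proof -
      obtain x y where x: "x \<in> A" "a = x [^] m" "y \<in> A" "b = y [^] m" using ab by blast
      have "a \<otimes> b = (x \<otimes> y) [^] m" using x c comm by (simp add: pow_mult_distrib)
      then show ?thesis using subgroup.m_closed[OF Ad(1) x(1,3)] by blast
    qed
  qed
  ultimately show ?thesis by (simp add: definable_subgroup_def)
qed

lemma conn_mult_abelian:
  assumes "conn L" "conn B" "L \<subseteq> A" "B \<subseteq> A" "A \<subseteq> carrier G" "\<And>x y. x \<in> A \<Longrightarrow> y \<in> A \<Longrightarrow> x \<otimes> y = y \<otimes> x"
  shows "conn (L <#> B)"
proof (rule conn_mult[OF assms(1,2)])
  fix a l assume "a \<in> B" "l \<in> L"
  then have "a \<otimes> l = l \<otimes> a" "a \<in> carrier G" "l \<in> carrier G" using assms by blast+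
  then show "a \<otimes> l \<otimes> inv a \<in> L" using \<open>l \<in> L\<close> by (simp add: m_assoc)
qed

text \<open>For subgroups \<open>J \<le> A\<close> of an abelian group: \<open>A/J\<close> is torsion-free.\<close>

definition torsion_closed :: "'a list set \<Rightarrow> 'a list set \<Rightarrow> bool" where
  "torsion_closed J A \<longleftrightarrow> (\<forall>a\<in>A. \<forall>n::nat. n > 0 \<and> a [^] n \<in> J \<longrightarrow> a \<in> J)"

definition largest_proper :: "'a list set \<Rightarrow> 'a list set \<Rightarrow> bool" where
  "largest_proper J A \<longleftrightarrow> dsub J \<and> J \<subset> A \<and> (\<forall>B. dsub B \<longrightarrow> B \<subset> A \<longrightarrow> B \<subseteq> J)"

text \<open>As \<open>A\<close> is indecomposable, the connected candidates for the radical are just the proper connected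
  definable subgroups, and they are closed under products; so, by the ascending chain condition, the
  radical exists and contains them all.
  A proper definable subgroup has a connected subgroup of finite index in the radical, and
  torsion-freeness of the quotient forces the rest into the radical too. The same argument shows that \<open>A\<close>
  has no proper definable subgroup of finite index.\<close>

lemma radical_is_largest_proper:
  assumes A: "dsub A" "A \<noteq> {\<one>}" and comm: "\<And>x y. x \<in> A \<Longrightarrow> y \<in> A \<Longrightarrow> x \<otimes> y = y \<otimes> x"
    and ind: "indecomposable M k G A" and tf: "torsion_free (radical_quotient M k G A)"
  shows "largest_proper (radical M k G A) A" "torsion_closed (radical M k G A) A" "conn A"
proof -
  note Ad = dsubD[OF A(1)]
  define J where "J = radical M k G A"
  have ind': "A1 <#> A2 \<noteq> A" if "dsub A1" "A1 \<subset> A" "dsub A2" "A2 \<subset> A" for A1 A2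
    using ind that unfolding indecomposable_def by blast
  have cand: "radical_candidate M k G A B \<longleftrightarrow> conn B \<and> B \<subset> A" for B
    unfolding radical_candidate_def definable_supplement_def using ind' connD(1) by blast
  have one: "\<one> \<in> A" using subgroup.one_closed[OF Ad(1)] .
  obtain L where L: "L \<in> {B. conn B \<and> B \<subset> A}" "\<And>K. K \<in> {B. conn B \<and> B \<subset> A} \<Longrightarrow> \<not> L \<subset> K"
  proof (rule maximal_conn[of "{B. conn B \<and> B \<subset> A}"])
    show "{B. conn B \<and> B \<subset> A} \<noteq> {}" using conn_one one A(2) by blast
  qed auto
  then have L': "conn L" "L \<subset> A" by auto
  have below: "B \<subseteq> L" if B: "conn B" "B \<subset> A" for B
  proof -
    note s = subset_set_mult[OF dsubD(1)[OF connD(1)[OF L'(1)]] dsubD(1)[OF connD(1)[OF B(1)]]]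
    have "conn (L <#> B)" by (rule conn_mult_abelian[OF L'(1) B(1) _ _ Ad(3) comm]) (use L' B in auto)
    moreover have "L <#> B \<subseteq> A" by (rule set_mult_subset[OF Ad(1)]) (use L' B in auto)
    moreover have "L <#> B \<noteq> A" using ind' L' B connD(1) by blast
    ultimately have "\<not> L \<subset> L <#> B" using L(2)[of "L <#> B"] by blast
    then show ?thesis using s by blast
  qed
  have "J = L" unfolding J_def radical_def cand
  proof (rule the_equality)
    show "(conn L \<and> L \<subset> A) \<and> (\<nexists>B. (conn B \<and> B \<subset> A) \<and> L \<subset> B)" using L' below by blast
    fix J' assume "(conn J' \<and> J' \<subset> A) \<and> (\<nexists>B. (conn B \<and> B \<subset> A) \<and> J' \<subset> B)"
    then show "J' = L" using L' below[of J'] by blast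
  qed
  note Jd = dsubD[OF connD(1)[OF L'(1)], folded \<open>J = L\<close>]
  have JA: "J \<subset> A" using L' \<open>J = L\<close> by simp
  have tc: "torsion_closed J A"
    using tf torsion_free_quotient_iff[OF Ad(1) Jd(1) _ comm] JA
    unfolding radical_quotient_def torsion_closed_def J_def[symmetric] by blast
  then show "torsion_closed (radical M k G A) A" unfolding J_def .
  have fi: "H \<subseteq> J" if H: "dsub H" "H \<subseteq> A" "dsub C" "C \<subseteq> H" "finite_index C H" "C \<subseteq> J" for H C
  proof
    fix b assume b: "b \<in> H"
    obtain m :: nat where "m > 0" "\<And>x. x \<in> H \<Longrightarrow> x [^] m \<in> C"
      by (rule finite_index_pow[OF dsubD(1)[OF H(1)] dsubD(1)[OF H(3)] H(4) _ H(5)]) (use comm H(2) in blast)+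
    then show "b \<in> J" using tc b H(2,6) unfolding torsion_closed_def by blast
  qed
  have top: "B \<subseteq> J" if B: "dsub B" "B \<subset> A" for B
  proof -
    obtain C where C: "conn C" "C \<subseteq> B" "finite_index C B" by (rule connected_component[OF B(1)])
    have "C \<subseteq> J" unfolding \<open>J = L\<close> by (rule below) (use C B in auto)
    then show ?thesis using fi[OF B(1) _ connD(1)[OF C(1)] C(2,3)] B(2) by blast
  qed
  then show "largest_proper (radical M k G A) A"
    using JA connD(1)[OF L'(1)] \<open>J = L\<close> unfolding largest_proper_def J_def[symmetric] by auto
  show "conn A"
  proof (rule connI[OF A(1)])
    fix K assume K: "dsub K" "K \<subseteq> A" "finite_index K A"
    show "A \<subseteq> K"
    proof (rule ccontr)
      assume "\<not> A \<subseteq> K"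
      then have "K \<subseteq> J" using top[OF K(1)] K(2) by blast
      then have "A \<subseteq> J" using fi[OF A(1) _ K(1,2,3)] by blast
      then show False using JA by blast
    qed
  qed
qed

text \<open>The only delicate point is that \<open>J\<close> is connected. Let \<open>K\<close> have finite index in \<open>J\<close>, with \<open>m\<close>-th powers of
  elements of \<open>J\<close> lying in \<open>K\<close>. The subgroup of \<open>m\<close>-th powers of \<open>A\<close>, multiplied with \<open>K\<close>, is not contained
  in \<open>J\<close>, by torsion-freeness; so it is all of \<open>A\<close>. Hence every \<open>x \<in> J\<close> is \<open>y [^] m\<close> up to \<open>K\<close>, where \<open>y\<close>
  lies in \<open>J\<close> by torsion-freeness again, and then \<open>y [^] m \<in> K\<close>.\<close>

lemma largest_proper_is_radical:
  assumes A: "dsub A" and comm: "\<And>x y. x \<in> A \<Longrightarrow> y \<in> A \<Longrightarrow> x \<otimes> y = y \<otimes> x"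
    and J: "largest_proper J A" and tc: "torsion_closed J A"
  shows "indecomposable M k G A" "radical M k G A = J" "torsion_free (radical_quotient M k G A)"
proof -
  note Ad = dsubD[OF A]
  have J': "dsub J" "J \<subset> A" "\<And>B. dsub B \<Longrightarrow> B \<subset> A \<Longrightarrow> B \<subseteq> J" using J unfolding largest_proper_def by auto
  note Jd = dsubD[OF J'(1)]
  have no: "A1 <#> A2 \<noteq> A" if "dsub A1" "A1 \<subset> A" "dsub A2" "A2 \<subset> A" for A1 A2
  proof -
    have "A1 <#> A2 \<subseteq> J" by (rule set_mult_subset[OF Jd(1)]) (use that J'(3) in auto)
    then show ?thesis using J'(2) by blast
  qed
  show ind: "indecomposable M k G A" unfolding indecomposable_def using no by blast
  have cJ: "conn J"
  proof (rule connI[OF J'(1)])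
    fix K assume K: "dsub K" "K \<subseteq> J" "finite_index K J"
    obtain m :: nat where m: "m > 0" "\<And>x. x \<in> J \<Longrightarrow> x [^] m \<in> K"
      by (rule finite_index_pow[OF Jd(1) dsubD(1)[OF K(1)] K(2) _ K(3)]) (use comm J'(2) in blast)+
    let ?P = "(\<lambda>x. x [^] m) ` A"
    have P: "dsub ?P" by (rule dsub_pow_image[OF A comm])
    have PA: "?P \<subseteq> A"
    proof
      fix y assume "y \<in> ?P"
      then obtain x where x: "x \<in> A" "y = x [^] m" by blast
      have "x [^] j \<in> A" for j :: nat
        by (induction j) (use subgroup.one_closed[OF Ad(1)] subgroup.m_closed[OF Ad(1) _ x(1)] in auto)
      then show "y \<in> A" using x by blast
    qed
    have KA: "K \<subseteq> A" using K J' by blast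
    have c: "x \<in> carrier G" if "x \<in> A" for x using that Ad(3) by blast
    have PK: "dsub (?P <#> K)"
    proof (rule dsub_mult[OF P K(1)])
      fix a l assume al: "a \<in> K" "l \<in> ?P"
      then have "a \<in> A" "l \<in> A" using KA PA by blast+
      then show "a \<otimes> l \<otimes> inv a \<in> ?P" using comm[of a l] c al by (simp add: m_assoc)
    qed
    have PKA: "?P <#> K \<subseteq> A" by (rule set_mult_subset[OF Ad(1) PA KA])
    have "?P <#> K = A"
    proof (rule ccontr)
      assume "?P <#> K \<noteq> A"
      then have "?P <#> K \<subseteq> J" using J'(3)[OF PK] PKA by blast
      then have "x [^] m \<in> J" if "x \<in> A" for x
        using that subset_set_mult(1)[OF dsubD(1)[OF P] dsubD(1)[OF K(1)]] by blast
      then have "A \<subseteq> J" using tc m(1) unfolding torsion_closed_def by blast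
      then show False using J'(2) by blast
    qed
    show "J \<subseteq> K"
    proof
      fix x assume x: "x \<in> J"
      then have "x \<in> ?P <#> K" using J'(2) \<open>?P <#> K = A\<close> by blast
      then obtain y z where y: "y \<in> A" "z \<in> K" "x = y [^] m \<otimes> z" unfolding set_mult_def by blast
      have zJ: "z \<in> J" using y(2) K(2) by blast
      have cc: "y \<in> carrier G" "z \<in> carrier G" using y c KA by blast+
      have "y [^] m = x \<otimes> inv z" using y(3) cc by (simp add: m_assoc)
      then have "y [^] m \<in> J" using x zJ by (simp add: subgroup.m_closed[OF Jd(1)] subgroup.m_inv_closed[OF Jd(1)])
      then have "y \<in> J" using tc m(1) y(1) unfolding torsion_closed_def by blast
      then have "y [^] m \<in> K" by (rule m(2))
      then show "x \<in> K" using y by (simp add: subgroup.m_closed[OF dsubD(1)[OF K(1)]])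
    qed
  qed
  have cand: "radical_candidate M k G A B \<longleftrightarrow> conn B \<and> B \<subset> A" for B
    unfolding radical_candidate_def definable_supplement_def using no connD(1) by blast
  show rad: "radical M k G A = J" unfolding radical_def cand
  proof (rule the_equality)
    show "(conn J \<and> J \<subset> A) \<and> (\<nexists>B. (conn B \<and> B \<subset> A) \<and> J \<subset> B)" using cJ J' connD(1) by blast
    fix J' assume "(conn J' \<and> J' \<subset> A) \<and> (\<nexists>B. (conn B \<and> B \<subset> A) \<and> J' \<subset> B)"
    then show "J' = J" using cJ J'(2) \<open>\<And>B. dsub B \<Longrightarrow> B \<subset> A \<Longrightarrow> B \<subseteq> J\<close>[of J'] connD(1) by blast
  qed
  show "torsion_free (radical_quotient M k G A)"
    using tc torsion_free_quotient_iff[OF Ad(1) Jd(1) _ comm] J'(2)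
    unfolding radical_quotient_def rad torsion_closed_def by blast
qed

section \<open>Ranks of quotients\<close>

lemma coset_relation_pform:
  assumes A: "dsub A" and B: "dsub B" and P: "dsub P"
  obtains T where "params_in M T"
    "\<And>x y. x \<in> tuples M k \<Longrightarrow> y \<in> tuples M k \<Longrightarrow>
       x @ y \<in> defined_set M (2 * k) T \<longleftrightarrow> x \<in> A \<and> y \<in> B \<and> (\<exists>p\<in>P. x = p \<otimes> y)"
    "defined_set M (2 * k) T = {x @ y | x y. x \<in> A \<and> y \<in> B \<and> (\<exists>p\<in>P. x = p \<otimes> y)}"
proof -
  note sub = dsubD(3)[OF A] dsubD(3)[OF B] dsubD(3)[OF P]
  have "mdef (\<lambda>V. V 0 \<in> A \<and> V 1 \<in> B \<and> (\<exists>p\<in>P. V 0 = p \<otimes> V 1))"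
    by (rule codefinable_cong[OF codefinable_conj[OF mdef_mem[OF dsubD(2)[OF A], of 0] codefinable_conj[OF mdef_mem[OF dsubD(2)[OF B], of 1]
            codefinable_ex[where b = 2, OF codefinable_conj[OF mdef_mem[OF dsubD(2)[OF P], of 2] mdef_mult[of 2 1 0]]]]]])
       (use sub carrier_tuples in \<open>auto simp: subset_iff\<close>)
  then obtain T where T: "params_in M T"
    "\<And>x y. x \<in> tuples M k \<Longrightarrow> y \<in> tuples M k \<Longrightarrow>
       x @ y \<in> defined_set M (2 * k) T \<longleftrightarrow> x \<in> A \<and> y \<in> B \<and> (\<exists>p\<in>P. x = p \<otimes> y)"
    "defined_set M (2 * k) T = {x @ y | x y. x \<in> tuples M k \<and> y \<in> tuples M k \<and> x \<in> A \<and> y \<in> B \<and> (\<exists>p\<in>P. x = p \<otimes> y)}"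
    by (rule definable_rel) simp
  have "x \<in> tuples M k" if "x \<in> A \<or> x \<in> B" for x using that sub carrier_tuples by blast
  then have "defined_set M (2 * k) T = {x @ y | x y. x \<in> A \<and> y \<in> B \<and> (\<exists>p\<in>P. x = p \<otimes> y)}"
    unfolding T(3) by blast
  with T(1,2) show ?thesis by (rule that)
qed

lemma coset_relation:
  assumes B: "dsub B" and P: "dsub P"
  shows "\<Union>((\<lambda>x. (B \<inter> P) #> x) ` B) = B"
    "{x @ y | x y. \<exists>C\<in>(\<lambda>x. (B \<inter> P) #> x) ` B. x \<in> C \<and> y \<in> C} = {x @ y | x y. x \<in> B \<and> y \<in> B \<and> (\<exists>p\<in>P. x = p \<otimes> y)}"
proof -
  let ?K = "B \<inter> P"
  note Bd = dsubD[OF B] and Kd = dsubD[OF dsub_inter[OF B P]]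
  have c: "x \<in> carrier G" if "x \<in> B" for x using that Bd(3) by blast
  have s: "?K #> x \<subseteq> B" if "x \<in> B" for x
    using that subgroup.m_closed[OF Bd(1) _ that] by (auto simp: r_coset_def)
  show "\<Union>((\<lambda>x. ?K #> x) ` B) = B" using s rcos_self[OF c Kd(1)] by blast
  have "(\<exists>C\<in>(\<lambda>x. ?K #> x) ` B. x \<in> C \<and> y \<in> C) \<longleftrightarrow> x \<in> B \<and> y \<in> B \<and> (\<exists>p\<in>P. x = p \<otimes> y)" for x y
  proof
    assume "\<exists>C\<in>(\<lambda>x. ?K #> x) ` B. x \<in> C \<and> y \<in> C"
    then obtain z where z: "z \<in> B" "x \<in> ?K #> z" "y \<in> ?K #> z" by blast
    then have xy: "x \<in> B" "y \<in> B" using s by blast+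
    have "?K #> x = ?K #> y"
      using repr_independence[OF z(2) c[OF z(1)] Kd(1)] repr_independence[OF z(3) c[OF z(1)] Kd(1)] by simp
    then have "x \<otimes> inv y \<in> P" using r_coset_eq_iff[OF Kd(1) c[OF xy(1)] c[OF xy(2)]] by blast
    moreover have "x = x \<otimes> inv y \<otimes> y" using c xy by (simp add: m_assoc)
    ultimately show "x \<in> B \<and> y \<in> B \<and> (\<exists>p\<in>P. x = p \<otimes> y)" using xy by blast
  next
    assume "x \<in> B \<and> y \<in> B \<and> (\<exists>p\<in>P. x = p \<otimes> y)"
    then obtain p where p: "x \<in> B" "y \<in> B" "p \<in> P" "x = p \<otimes> y" by blast
    have "p \<in> carrier G" using p(3) dsubD(3)[OF P] by blast
    then have "p = x \<otimes> inv y" using p c by (simp add: m_assoc)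
    moreover have "x \<otimes> inv y \<in> B"
      using p(1,2) by (simp add: subgroup.m_closed[OF Bd(1)] subgroup.m_inv_closed[OF Bd(1)])
    ultimately have "p \<in> B" by simp
    then have "x \<in> ?K #> y" using p unfolding r_coset_def by blast
    then show "\<exists>C\<in>(\<lambda>x. ?K #> x) ` B. x \<in> C \<and> y \<in> C" using p rcos_self[OF c[OF p(2)] Kd(1)] by blast
  qed
  then show "{x @ y | x y. \<exists>C\<in>(\<lambda>x. ?K #> x) ` B. x \<in> C \<and> y \<in> C} = {x @ y | x y. x \<in> B \<and> y \<in> B \<and> (\<exists>p\<in>P. x = p \<otimes> y)}"
    by simp
qed

text \<open>Both \<open>A/(A \<inter> P)\<close> and \<open>A'/(A' \<inter> P)\<close> can be seen as families of cosets of \<open>P\<close>; if \<open>A \<le> P A'\<close> the first is contained in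
  the second, and \<open>T\<close> is this inclusion.\<close>

lemma rank_ge_quotient:
  assumes A: "dsub A" and A': "dsub A'" and P: "dsub P" and sub: "A \<subseteq> P <#> A'"
    and ge: "rank_ge M k ((\<lambda>x. (A \<inter> P) #> x) ` A) n"
  shows "rank_ge M k ((\<lambda>x. (A' \<inter> P) #> x) ` A') n"
proof -
  obtain E S and N :: "('a + 'f + 'r + nat, 'f, 'r) fo_structure" and h where
    S: "params_in M S" "defined_set M k S = A" and
    E: "params_in M E" "defined_set M (2 * k) E = {x @ y | x y. x \<in> A \<and> y \<in> A \<and> (\<exists>p\<in>P. x = p \<otimes> y)}" and
    h: "elementary_embedding M N h" and mo: "morley_ge n N k (transport h E) (transport h S)"
    using ge unfolding rank_ge_def coset_relation[OF A P] by blast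
  obtain S' where S': "params_in M S'" "defined_set M k S' = A'"
    using dsubD(2)[OF A'] unfolding definable_def by blast
  obtain E' where E': "params_in M E'" "\<And>x y. x \<in> tuples M k \<Longrightarrow> y \<in> tuples M k \<Longrightarrow>
       x @ y \<in> defined_set M (2 * k) E' \<longleftrightarrow> x \<in> A' \<and> y \<in> A' \<and> (\<exists>p\<in>P. x = p \<otimes> y)"
    "defined_set M (2 * k) E' = {x @ y | x y. x \<in> A' \<and> y \<in> A' \<and> (\<exists>p\<in>P. x = p \<otimes> y)}"
    by (rule coset_relation_pform[OF A' A' P]) (rule that)
  obtain T where T: "params_in M T" "\<And>x y. x \<in> tuples M k \<Longrightarrow> y \<in> tuples M k \<Longrightarrow>
       x @ y \<in> defined_set M (2 * k) T \<longleftrightarrow> x \<in> A \<and> y \<in> A' \<and> (\<exists>p\<in>P. x = p \<otimes> y)"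
    by (rule coset_relation_pform[OF A A' P]) (rule that)
  note Pd = dsubD[OF P]
  have c: "x \<in> carrier G" if "x \<in> A \<or> x \<in> A' \<or> x \<in> P" for x
    using that dsubD(3)[OF A] dsubD(3)[OF A'] Pd(3) by blast
  have "quotient_embedding M k E S E' S' T"
    unfolding quotient_embedding_def S(2) S'(2)
  proof (intro conjI ballI impI; (elim conjE)?)
    fix x assume x: "x \<in> tuples M k" "x \<in> A"
    then obtain p y where "p \<in> P" "y \<in> A'" "x = p \<otimes> y" using sub unfolding set_mult_def by blast
    then show "\<exists>y\<in>tuples M k. x @ y \<in> defined_set M (2 * k) T"
      using x T(2) carrier_tuples[OF c] by blast
  next
    fix x y z assume t: "x \<in> tuples M k" "y \<in> tuples M k" "z \<in> tuples M k"
      and "x \<in> A" "x @ y \<in> defined_set M (2 * k) T" "y @ z \<in> defined_set M (2 * k) E'"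
    then obtain p q where pq: "p \<in> P" "x = p \<otimes> y" "q \<in> P" "y = q \<otimes> z" "z \<in> A'" "x \<in> A" using T(2) E'(2) by blast
    then have "x = (p \<otimes> q) \<otimes> z" using c by (simp add: m_assoc)
    then show "x @ z \<in> defined_set M (2 * k) T"
      using T(2)[OF t(1,3)] subgroup.m_closed[OF Pd(1) pq(1,3)] pq by blast
  next
    fix x x' y assume t: "x \<in> tuples M k" "x' \<in> tuples M k" "y \<in> tuples M k"
      and x: "x \<in> A" "x' \<in> A" and "x @ y \<in> defined_set M (2 * k) T" "x' @ y \<in> defined_set M (2 * k) T"
    then obtain p q where pq: "p \<in> P" "x = p \<otimes> y" "q \<in> P" "x' = q \<otimes> y" "y \<in> A'" using T(2) by blast
    have "inv q \<otimes> x' = y" using pq c by (simp flip: m_assoc)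
    then have "x = (p \<otimes> inv q) \<otimes> x'" using pq c by (simp add: m_assoc)
    moreover have "p \<otimes> inv q \<in> P" using pq by (simp add: subgroup.m_closed[OF Pd(1)] subgroup.m_inv_closed[OF Pd(1)])
    ultimately show "x @ x' \<in> defined_set M (2 * k) E" unfolding E(2) using x by blast
  qed (use T(2) in blast)
  note quotient_embedding_transfer[OF h E(1) S(1) E'(1) S'(1) T(1) this]
  then have "morley_ge n N k (transport h E') (transport h S')"
    by (rule morley_ge_embedding[OF mo]) (intro params_in_transport[OF h] E S E' S' T)+
  then show ?thesis unfolding rank_ge_def coset_relation[OF A' P] using S' E' h by blast
qed

lemma reduced_rank_alt:
  "reduced_rank M k G A = rk M k ((\<lambda>x. radical M k G A #> x) ` A)"
  unfolding reduced_rank_def radical_quotient_def FactGroup_def by (simp add: rcosets_carrier_update)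

section \<open>Generation by U-subgroups\<close>

definition U0_generator :: "int \<Rightarrow> 'a list set \<Rightarrow> bool" where
  "U0_generator r A \<longleftrightarrow> definable_subgroup M k G A \<and> A \<noteq> {\<one>} \<and> comm_group (G\<lparr>carrier := A\<rparr>) \<and>
     indecomposable M k G A \<and> reduced_rank M k G A = r \<and> torsion_free (radical_quotient M k G A)"

lemma U0_eq: "U0 M k G r H = generate G (\<Union>{A. U0_generator r A \<and> A \<subseteq> H})"
  unfolding U0_def U0_generator_def by (rule arg_cong[of _ _ "generate G"]) blast

lemma comm_subgroup_iff:
  assumes "subgroup A G"
  shows "comm_group (G\<lparr>carrier := A\<rparr>) \<longleftrightarrow> (\<forall>x\<in>A. \<forall>y\<in>A. x \<otimes> y = y \<otimes> x)"
proof
  assume "comm_group (G\<lparr>carrier := A\<rparr>)"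
  then interpret H: comm_group "G\<lparr>carrier := A\<rparr>" .
  show "\<forall>x\<in>A. \<forall>y\<in>A. x \<otimes> y = y \<otimes> x" using H.m_comm by simp
next
  interpret H: group "G\<lparr>carrier := A\<rparr>" by (rule subgroup_imp_group[OF assms])
  assume "\<forall>x\<in>A. \<forall>y\<in>A. x \<otimes> y = y \<otimes> x"
  then show "comm_group (G\<lparr>carrier := A\<rparr>)" by (intro H.group_comm_groupI) simp
qed

text \<open>The centre of the centralizer of \<open>h\<close>, cut down to \<open>H\<close>.\<close>

lemma definable_abelian_hull:
  assumes H: "dsub H" and h: "h \<in> H"
  obtains D where "dsub D" "D \<subseteq> H" "h \<in> D" "\<And>x y. x \<in> D \<Longrightarrow> y \<in> D \<Longrightarrow> x \<otimes> y = y \<otimes> x"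
proof -
  have hc: "h \<in> carrier G" using h dsubD(3)[OF H] by blast
  define C where "C = {x \<in> carrier G. x \<otimes> h = h \<otimes> x}"
  have Cd: "definable M k C" unfolding C_def by (rule definable_centralizer[OF hc])
  have commute_inv: "inv x \<otimes> y = y \<otimes> inv x" if "x \<in> carrier G" "y \<in> carrier G" "x \<otimes> y = y \<otimes> x" for x y
  proof -
    have "inv x \<otimes> y = inv x \<otimes> (y \<otimes> x) \<otimes> inv x" using that(1,2) by (simp add: m_assoc)
    also have "\<dots> = inv x \<otimes> (x \<otimes> y) \<otimes> inv x" using that(3) by simp
    also have "\<dots> = y \<otimes> inv x" using that(1,2) by (simp flip: m_assoc)
    finally show ?thesis .
  qed
  have commute_mult: "x \<otimes> y \<otimes> z = z \<otimes> (x \<otimes> y)"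
    if "x \<in> carrier G" "y \<in> carrier G" "z \<in> carrier G" "x \<otimes> z = z \<otimes> x" "y \<otimes> z = z \<otimes> y" for x y z
    by (metis m_assoc that)
  have Cs: "subgroup C G"
    by (rule subgroupI) (use hc commute_inv commute_mult in \<open>auto simp: C_def\<close>)
  have Cc: "C \<subseteq> carrier G" by (auto simp: C_def)
  have "subgroup (center C) G"
  proof (rule subgroupI)
    show "center C \<subseteq> carrier G" using Cc by (auto simp: center_def)
    have "\<one> \<in> center C" using subgroup.one_closed[OF Cs] Cc by (auto simp: center_def)
    then show "center C \<noteq> {}" by blast
    show "inv a \<in> center C" if "a \<in> center C" for a
    proof -
      have a: "a \<in> C" "\<And>y. y \<in> C \<Longrightarrow> a \<otimes> y = y \<otimes> a" using that by (auto simp: center_def)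
      have "inv a \<otimes> y = y \<otimes> inv a" if "y \<in> C" for y
        using commute_inv[OF _ _ a(2)[OF that]] a that Cc by blast
      then show ?thesis using subgroup.m_inv_closed[OF Cs a(1)] by (simp add: center_def)
    qed
    show "a \<otimes> b \<in> center C" if "a \<in> center C" "b \<in> center C" for a b
    proof -
      have a: "a \<in> C" "\<And>y. y \<in> C \<Longrightarrow> a \<otimes> y = y \<otimes> a" "b \<in> C" "\<And>y. y \<in> C \<Longrightarrow> b \<otimes> y = y \<otimes> b"
        using that by (auto simp: center_def)
      have "a \<otimes> b \<otimes> y = y \<otimes> (a \<otimes> b)" if "y \<in> C" for y
        using commute_mult[OF _ _ _ a(2)[OF that] a(4)[OF that]] a that Cc by blast
      then show ?thesis using subgroup.m_closed[OF Cs a(1,3)] by (simp add: center_def)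
    qed
  qed
  then have "dsub (center C)" using definable_center[OF Cd Cc] by (simp add: definable_subgroup_def)
  then have d: "dsub (center C \<inter> H)" using H by (rule dsub_inter)
  have "h \<in> center C" using hc by (auto simp: center_def C_def)
  then have hD: "h \<in> center C \<inter> H" using h by blast
  have "x \<otimes> y = y \<otimes> x" if "x \<in> center C \<inter> H" "y \<in> center C \<inter> H" for x y
    using that unfolding center_def by blast
  with d Int_lower2 hD show ?thesis by (rule that)
qed

lemma U0_generator_radical:
  assumes "U0_generator r A"
  shows "largest_proper (radical M k G A) A" "torsion_closed (radical M k G A) A" "conn A"
    "x \<in> A \<Longrightarrow> y \<in> A \<Longrightarrow> x \<otimes> y = y \<otimes> x"
proof -
  have A: "dsub A" "A \<noteq> {\<one>}" "indecomposable M k G A" "torsion_free (radical_quotient M k G A)"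
    using assms by (auto simp: U0_generator_def)
  have comm: "x \<otimes> y = y \<otimes> x" if "x \<in> A" "y \<in> A" for x y
    using assms that comm_subgroup_iff[OF dsubD(1)[OF A(1)]] by (auto simp: U0_generator_def)
  show "largest_proper (radical M k G A) A" "torsion_closed (radical M k G A) A" "conn A"
    by (rule radical_is_largest_proper[OF A(1,2) comm A(3,4)]; assumption)+
  show "x \<in> A \<Longrightarrow> y \<in> A \<Longrightarrow> x \<otimes> y = y \<otimes> x" by (rule comm)
qed

text \<open>In \<open>G/N\<close>, an image of \<open>A\<close>, the subgroup \<open>N J\<close> is the image of the radical \<open>J\<close> of \<open>A\<close>. It stays proper because
  \<open>A \<inter> N\<close>, being a proper definable subgroup of \<open>A\<close>, is already contained in \<open>J\<close>.\<close>

lemma radical_preimage: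
  assumes N: "dsub N" "\<And>g x. g \<in> carrier G \<Longrightarrow> x \<in> N \<Longrightarrow> g \<otimes> x \<otimes> inv g \<in> N" "N \<noteq> carrier G"
    and A: "U0_generator r A" and NA: "N <#> A = carrier G"
  shows "dsub (N <#> radical M k G A)" "A \<inter> (N <#> radical M k G A) = radical M k G A"
proof -
  define J where "J = radical M k G A"
  have Ad: "dsub A" using A by (simp add: U0_generator_def)
  note As = dsubD[OF Ad] and Ns = dsubD[OF N(1)]
  have J: "dsub J" "J \<subset> A" "\<And>B. dsub B \<Longrightarrow> B \<subset> A \<Longrightarrow> B \<subseteq> J"
    using U0_generator_radical(1)[OF A] by (auto simp: largest_proper_def J_def)
  note Js = dsubD[OF J(1)]
  have NAJ: "A \<inter> N \<subseteq> J"
  proof (rule J(3)[OF dsub_inter[OF Ad N(1)]])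
    have "\<not> A \<subseteq> N" using set_mult_subset[OF Ns(1), of N A] NA N(3) Ns(3) by blast
    then show "A \<inter> N \<subset> A" by blast
  qed
  show "dsub (N <#> radical M k G A)"
    unfolding J_def[symmetric] by (rule dsub_mult[OF N(1) J(1)]) (use N(2) Js(3) in blast)
  have "A \<inter> (N <#> J) = J"
  proof
    show "J \<subseteq> A \<inter> (N <#> J)" using subset_set_mult(2)[OF Ns(1) Js(1)] J(2) by blast
    show "A \<inter> (N <#> J) \<subseteq> J"
    proof
      fix a assume a: "a \<in> A \<inter> (N <#> J)"
      then obtain n j where nj: "n \<in> N" "j \<in> J" "a = n \<otimes> j" unfolding set_mult_def by blast
      have jA: "j \<in> A" using nj J(2) by blast
      have "n \<in> carrier G" "j \<in> carrier G" using nj Ns(3) Js(3) by blast+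
      then have "n = a \<otimes> inv j" using nj(3) by (simp add: m_assoc)
      moreover have "a \<otimes> inv j \<in> A" using a jA by (simp add: subgroup.m_closed[OF As(1)] subgroup.m_inv_closed[OF As(1)])
      ultimately have "n \<in> J" using nj NAJ by blast
      then show "a \<in> J" using nj subgroup.m_closed[OF Js(1)] by blast
    qed
  qed
  then show "A \<inter> (N <#> radical M k G A) = radical M k G A" unfolding J_def .
qed

text \<open>Put \<open>P = N J\<close>, where \<open>J\<close> is the radical of \<open>A\<close>. A subgroup \<open>B\<close> of \<open>H\<close> that is minimal among definable abelian
  subgroups not inside \<open>P\<close> covers \<open>G/N\<close>: otherwise \<open>A \<inter> N B\<close> is proper in \<open>A\<close>, hence in \<open>J\<close>, and then
  \<open>B \<le> P\<close>. So \<open>B/(B \<inter> P)\<close>, \<open>G/P\<close> and \<open>A/J\<close> are the same, and by minimality \<open>B \<inter> P\<close> is the largest proper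
  definable subgroup of \<open>B\<close>.\<close>

lemma pull_back:
  assumes N: "dsub N" and norm: "\<And>g x. g \<in> carrier G \<Longrightarrow> x \<in> N \<Longrightarrow> g \<otimes> x \<otimes> inv g \<in> N" "N \<noteq> carrier G"
    and A: "U0_generator r A" and NA: "N <#> A = carrier G"
    and H: "dsub H" and gen: "\<not> H \<subseteq> N <#> radical M k G A"
  obtains B where "U0_generator r B" "B \<subseteq> H" "\<not> B \<subseteq> N"
proof -
  define J where "J = radical M k G A"
  have Ad: "dsub A" and rr: "reduced_rank M k G A = r" using A by (auto simp: U0_generator_def)
  note As = dsubD[OF Ad] and Ns = dsubD[OF N]
  have J: "dsub J" "J \<subset> A" "\<And>B. dsub B \<Longrightarrow> B \<subset> A \<Longrightarrow> B \<subseteq> J"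
    using U0_generator_radical(1)[OF A] by (auto simp: largest_proper_def J_def)
  have tc: "a \<in> J" if "a \<in> A" "n > 0" "a [^] n \<in> J" for a and n :: nat
    using U0_generator_radical(2)[OF A] that unfolding torsion_closed_def J_def by blast
  define P where "P = N <#> J"
  have Pd: "dsub P" and AP: "A \<inter> P = J"
    using radical_preimage[OF N norm A NA] unfolding P_def J_def by auto
  note Ps = dsubD[OF Pd] and NP = subset_set_mult[OF Ns(1) dsubD(1)[OF J(1)], folded P_def]
  have c: "x \<in> carrier G" if "x \<in> A \<or> x \<in> N \<or> x \<in> P" for x
    using that As(3) Ns(3) Ps(3) by blast
  obtain h where h: "h \<in> H" "h \<notin> P" using gen unfolding P_def J_def by blast
  obtain D where D: "dsub D" "D \<subseteq> H" "h \<in> D" "\<And>x y. x \<in> D \<Longrightarrow> y \<in> D \<Longrightarrow> x \<otimes> y = y \<otimes> x"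
    using definable_abelian_hull[OF H h(1)] by metis
  define S where "S = {B. dsub B \<and> B \<subseteq> D \<and> \<not> B \<subseteq> P}"
  have "S \<noteq> {}" using D h(2) unfolding S_def by blast
  then obtain B where B: "B \<in> S" "\<And>K. K \<in> S \<Longrightarrow> \<not> K \<subset> B"
    by (rule minimal_dsub[of S, rotated]) (auto simp: S_def)
  then have Bd: "dsub B" and BD: "B \<subseteq> D" and BP: "\<not> B \<subseteq> P" unfolding S_def by auto
  note Bs = dsubD[OF Bd]
  have Bcomm: "x \<otimes> y = y \<otimes> x" if "x \<in> B" "y \<in> B" for x y using that BD D(4) by blast
  have decomp: "\<exists>n\<in>N. \<exists>a\<in>A. g = n \<otimes> a" if "g \<in> carrier G" for g
    using that NA unfolding set_mult_def by blast
  have NBA: "A \<subseteq> N <#> B"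
  proof (rule ccontr)
    assume "\<not> A \<subseteq> N <#> B"
    moreover have NB: "dsub (N <#> B)" by (rule dsub_mult[OF N Bd]) (use norm(1) Bs(3) in blast)
    ultimately have le: "A \<inter> (N <#> B) \<subseteq> J" by (intro J(3) dsub_inter Ad) auto
    obtain b where b: "b \<in> B" "b \<notin> P" using BP by blast
    have bc: "b \<in> carrier G" using b Bs(3) by blast
    obtain n a where na: "n \<in> N" "a \<in> A" "b = n \<otimes> a" using decomp[OF bc] by blast
    have "inv n \<otimes> b = a" unfolding na(3) using na c by (simp flip: m_assoc)
    then have "a \<in> N <#> B"
      using b subgroup.m_inv_closed[OF Ns(1) na(1)] unfolding set_mult_def by blast
    then have "a \<in> J" using le na by blast
    then have "b \<in> P" unfolding P_def set_mult_def using na by blast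
    then show False using b by blast
  qed
  \<comment> \<open>Powers may be computed modulo the normal subgroup \<open>N\<close>.\<close>
  have pw: "\<exists>n'\<in>N. (n \<otimes> a) [^] (m::nat) = n' \<otimes> (a [^] m)" if na: "n \<in> N" "a \<in> A" for n a m
  proof (induction m)
    case 0
    show ?case by (rule bexI[OF _ subgroup.one_closed[OF Ns(1)]]) simp
  next
    case (Suc m)
    then obtain n' where n': "n' \<in> N" "(n \<otimes> a) [^] m = n' \<otimes> (a [^] m)" by blast
    have cc: "n' \<in> carrier G" "n \<in> carrier G" "a \<in> carrier G" "a [^] m \<in> carrier G" using n' na c by auto
    have "(n \<otimes> a) [^] Suc m = n' \<otimes> (a [^] m \<otimes> n \<otimes> inv (a [^] m)) \<otimes> (a [^] Suc m)"
      using n' cc by (simp add: m_assoc inv_solve_left)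
    moreover have "n' \<otimes> (a [^] m \<otimes> n \<otimes> inv (a [^] m)) \<in> N"
      using norm(1)[OF cc(4) na(1)] n'(1) subgroup.m_closed[OF Ns(1)] by blast
    ultimately show ?case by blast
  qed
  have top: "largest_proper (B \<inter> P) B"
    unfolding largest_proper_def
  proof (intro conjI allI impI)
    show "dsub (B \<inter> P)" by (rule dsub_inter[OF Bd Pd])
    show "B \<inter> P \<subset> B" using BP by blast
    fix K assume K: "dsub K" "K \<subset> B"
    then have "K \<notin> S" using B(2) by blast
    then show "K \<subseteq> B \<inter> P" using K BD unfolding S_def by blast
  qed
  have tcB: "torsion_closed (B \<inter> P) B"
    unfolding torsion_closed_def
  proof (intro ballI allI impI, elim conjE)
    fix b and m :: nat assume b: "b \<in> B" "m > 0" "b [^] m \<in> B \<inter> P"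
    have bc: "b \<in> carrier G" using b Bs(3) by blast
    obtain n a where na: "n \<in> N" "a \<in> A" "b = n \<otimes> a" using decomp[OF bc] by blast
    obtain n' where n': "n' \<in> N" "b [^] m = n' \<otimes> (a [^] m)" using pw[OF na(1,2)] na(3) by blast
    have am: "a [^] m \<in> A"
      by (induction m) (use subgroup.one_closed[OF As(1)] subgroup.m_closed[OF As(1) _ na(2)] in auto)
    have "inv n' \<otimes> (b [^] m) = a [^] m" unfolding n'(2) using n' am c by (simp flip: m_assoc)
    moreover have "inv n' \<in> P" using n'(1) NP subgroup.m_inv_closed[OF Ns(1)] by blast
    ultimately have "a [^] m \<in> P" using b subgroup.m_closed[OF Ps(1), of "inv n'" "b [^] m"] by simp
    then have "a \<in> J" using tc[OF na(2) b(2)] am AP by blast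
    then show "b \<in> B \<inter> P" using b na unfolding P_def set_mult_def by blast
  qed
  have res: "indecomposable M k G B" "radical M k G B = B \<inter> P" "torsion_free (radical_quotient M k G B)"
    by (rule largest_proper_is_radical[OF Bd _ top tcB]; rule Bcomm; assumption)+
  have "A \<subseteq> P <#> B" using NBA NP(1) unfolding set_mult_def by blast
  have "B \<subseteq> P <#> A" using decomp Bs(3) NP(1) unfolding set_mult_def by blast
  have rank: "rank_ge M k ((\<lambda>x. (A \<inter> P) #> x) ` A) n \<longleftrightarrow> rank_ge M k ((\<lambda>x. (B \<inter> P) #> x) ` B) n" for n
  proof
    assume "rank_ge M k ((\<lambda>x. (A \<inter> P) #> x) ` A) n"
    then show "rank_ge M k ((\<lambda>x. (B \<inter> P) #> x) ` B) n"
      by (rule rank_ge_quotient[OF Ad Bd Pd, rotated]) fact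
  next
    assume "rank_ge M k ((\<lambda>x. (B \<inter> P) #> x) ` B) n"
    then show "rank_ge M k ((\<lambda>x. (A \<inter> P) #> x) ` A) n"
      by (rule rank_ge_quotient[OF Bd Ad Pd, rotated]) fact
  qed
  have "reduced_rank M k G B = r"
  proof -
    have "reduced_rank M k G B = rk M k ((\<lambda>x. (A \<inter> P) #> x) ` A)"
      unfolding reduced_rank_alt res(2) rk_def rank ..
    then show ?thesis using rr unfolding reduced_rank_alt AP J_def by simp
  qed
  moreover have "B \<noteq> {\<one>}" using BP subgroup.one_closed[OF Ps(1)] by blast
  moreover have "comm_group (G\<lparr>carrier := B\<rparr>)" using Bcomm comm_subgroup_iff[OF Bs(1)] by blast
  ultimately have "U0_generator r B" using Bd res unfolding U0_generator_def by blast
  moreover have "\<not> B \<subseteq> N" using BP NP by blast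
  ultimately show ?thesis using that BD D(2) by blast
qed

text \<open>If the generators inside the groups \<open>H i\<close> generate a proper subgroup \<open>K\<close>, there is a proper definable
  normal \<open>N \<ge> K\<close> that a generator \<open>A\<close> supplements. Every \<open>H i\<close> must be contained in \<open>N J\<close>, since \<open>pull_back\<close> would
  otherwise give a generator in \<open>K\<close> outside \<open>N\<close>; but \<open>N J\<close> is proper.\<close>

lemma U0_generation:
  assumes U: "U0 M k G r (carrier G) = carrier G" and nil: "nilpotent G"
    and H: "\<And>i. i \<in> I \<Longrightarrow> dsub (H i)" and gen: "carrier G = generate G (\<Union>i\<in>I. H i)"
  shows "carrier G = generate G (\<Union>i\<in>I. U0 M k G r (H i))"
proof (rule ccontr)
  let ?F = "{A. U0_generator r A \<and> (\<exists>i\<in>I. A \<subseteq> H i)}"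
  define K where "K = generate G (\<Union>?F)"
  define K' where "K' = generate G (\<Union>i\<in>I. U0 M k G r (H i))"
  assume "carrier G \<noteq> generate G (\<Union>i\<in>I. U0 M k G r (H i))"
  then have ne: "carrier G \<noteq> K'" unfolding K'_def .
  have "U0 M k G r (H i) \<subseteq> carrier G" if "i \<in> I" for i
    unfolding U0_eq by (rule generate_subgroup_incl[OF _ subgroup_self]) (use H[OF that] dsubD(3) in blast)
  then have K'sub: "subgroup K' G" unfolding K'_def by (intro generate_is_subgroup) blast
  have KK': "K \<subseteq> K'"
    unfolding K_def
  proof (rule generate_subgroup_incl[OF _ K'sub], safe)
    fix x A i assume "x \<in> A" "U0_generator r A" "i \<in> I" "A \<subseteq> H i"
    then have "x \<in> U0 M k G r (H i)" unfolding U0_eq by (intro generate.incl) blast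
    then show "x \<in> K'" unfolding K'_def using \<open>i \<in> I\<close> by (intro generate.incl) blast
  qed
  have cK: "conn K" unfolding K_def by (rule generated_by_connected[OF nil]) (use U0_generator_radical(3) in blast)
  have Kne: "K \<subset> carrier G" using KK' subgroup.subset[OF K'sub] ne dsubD(3)[OF connD(1)[OF cK]] by blast
  have W: "carrier G = generate G (\<Union>{A. U0_generator r A \<and> A \<subseteq> carrier G})" using U unfolding U0_eq by simp
  obtain N A where N: "conn N" "K \<subseteq> N" "N \<subset> carrier G" "\<And>x. x \<in> carrier G \<Longrightarrow> conjugate x N = N"
    and A: "A \<in> {A. U0_generator r A \<and> A \<subseteq> carrier G}" "N <#> A = carrier G"
    by (rule proper_connected_cosubgroup[OF nil _ W cK Kne]) (use U0_generator_radical(3) in blast)+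
  then have genA: "U0_generator r A" by blast
  have norm: "g \<otimes> x \<otimes> inv g \<in> N" if "g \<in> carrier G" "x \<in> N" for g x
    using N(4)[OF that(1)] that(2) unfolding conjugate_def by blast
  have NH: "H i \<subseteq> N <#> radical M k G A" if i: "i \<in> I" for i
  proof (rule ccontr)
    assume "\<not> H i \<subseteq> N <#> radical M k G A"
    then obtain B where B: "U0_generator r B" "B \<subseteq> H i" "\<not> B \<subseteq> N"
      using pull_back[OF connD(1)[OF N(1)] norm _ genA A(2) H[OF i]] N(3) by blast
    then have "B \<subseteq> K" unfolding K_def using i generate.incl[of _ "\<Union>?F" G] by blast
    then show False using B N(2) by blast
  qed
  have P: "dsub (N <#> radical M k G A)" "A \<inter> (N <#> radical M k G A) = radical M k G A"
    using radical_preimage[OF connD(1)[OF N(1)] norm _ genA A(2)] N(3) by blast+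
  have "carrier G \<subseteq> N <#> radical M k G A"
    unfolding gen by (rule generate_subgroup_incl[OF _ dsubD(1)[OF P(1)]]) (use NH in blast)
  then have "A \<subseteq> radical M k G A" using P(2) A(1) by blast
  then show False using U0_generator_radical(1)[OF genA] unfolding largest_proper_def by blast
qed

end

theorem theorem2p9:
  fixes M :: "('a, 'f, 'r) fo_structure" and k :: nat and G :: "'a list monoid"
    and r :: int and n :: nat and H :: "nat \<Rightarrow> 'a list set"
  assumes "U0_group M k G r"
    and "nilpotent G"
    and "\<And>i. i \<in> {1..n} \<Longrightarrow> definable_subgroup M k G (H i)"
    and "carrier G = generate G (\<Union>i\<in>{1..n}. H i)"
  shows "carrier G = generate G (\<Union>i\<in>{1..n}. U0 M k G r (H i))"
proof -
  have fmr: "fmr_group M k G" and U: "U0 M k G r (carrier G) = carrier G"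
    using assms(1) by (simp_all add: U0_group_def)
  then have "group G" by (simp add: fmr_group_def)
  then interpret fmr_grp G M k by (intro fmr_grp.intro fmr_grp_axioms.intro fmr)
  show ?thesis by (rule U0_generation[OF U assms(2-4)])
qed

end
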